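(* There is a constant $K>0$ such that for every weight $\mu$ on $\mathbb{D}$ and every holomorphic $\phi:\mathbb{D}\to\mathbb{D}$ for which $C_\phi$ is bounded from $\mathcal{B}^{\log}$ to $\mathcal{B}^{\mu}$, $$\frac1K\,\|C_\phi\|_e^{\mathcal{B}^{\log}\to\mathcal{B}^{\mu}}\;\le\;\limsup_{j\to\infty}\frac{\|\phi^j\|_{\mu}}{\|F_j\|_{\log}}\;\le\;K\,\|C_\phi\|_e^{\mathcal{B}^{\log}\to\mathcal{B}^{\mu}} .$$
   Context: $\mathbb{D}$ is the open unit disk in $\mathbb{C}$, $\mathcal{H}(\mathbb{D})$ the space of holomorphic functions on $\mathbb{D}$, and $\log$ is the natural logarithm. A weight on $\mathbb{D}$ is a bounded, continuous, strictly positive function $\mu:\mathbb{D}\to(0,\infty)$. For a weight $\mu$ and $f\in\mathcal{H}(\mathbb{D})$, put $\|f\|_\mu:=\sup_{z\in\mathbb{D}}\mu(z)|f'(z)|$; the $\mu$-Bloch space $\mathcal{B}^\mu$ is the set of $f\in\mathcal{H}(\mathbb{D})$ with $\|f\|_\mu<\infty$, a Banach space under the norm $\|f\|_{\mathcal{B}^\mu}:=|f(0)|+\|f\|_\mu$. The log-Bloch space $\mathcal{B}^{\log}$ is $\mathcal{B}^{\mu}$ for the weight $\mu=v_{\log}$, $v_{\log}(z)=(1-|z|)\log\left(\frac{3}{1-|z|}\right)$; its seminorm $\|\cdot\|_{v_{\log}}$ is written $\|\cdot\|_{\log}$. $C_\phi f:=f\circ\phi$ is the composition operator with symbol $\phi$.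 $F_j(z):=z^j$ on $\mathbb{D}$, and $\phi^j$ is the pointwise $j$th power of $\phi$. For a bounded linear operator $T:X\to Y$ between normed linear spaces, the essential norm is $\|T\|_e^{X\to Y}:=\inf\{\|T-K\| : K:X\to Y \text{ compact linear}\}$, with $\|\cdot\|$ the operator norm. *)

theory Defs
  imports "HOL-Complex_Analysis.Complex_Analysis"
begin

abbreviation unit_disk :: "complex set" where
  "unit_disk \<equiv> ball 0 1"

definition weight :: "(complex \<Rightarrow> real) \<Rightarrow> bool" where
  "weight \<mu> \<longleftrightarrow> continuous_on unit_disk \<mu> \<and> bounded (\<mu> ` unit_disk) \<and> (\<forall>z\<in>unit_disk. 0 < \<mu> z)"

definition v_log :: "complex \<Rightarrow> real" where
  "v_log z = (1 - cmod z) * ln (3 / (1 - cmod z))"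

(* The supremum is taken in [0,\<infinity>], so it is meaningful without a boundedness assumption;
   it depends only on the values of f on the open unit disk. *)
definition bloch_seminorm :: "(complex \<Rightarrow> real) \<Rightarrow> (complex \<Rightarrow> complex) \<Rightarrow> ennreal" where
  "bloch_seminorm \<mu> f = (SUP z\<in>unit_disk. ennreal (\<mu> z * cmod (deriv f z)))"

(* Functions on the disk are represented by their extension by 0 to the whole plane. Two elements
   that agree on the disk are thus equal, and the norm below is definite. *)
definition bloch_space :: "(complex \<Rightarrow> real) \<Rightarrow> (complex \<Rightarrow> complex) set" where
  "bloch_space \<mu> = {f. f holomorphic_on unit_disk \<and> (\<forall>z. z \<notin> unit_disk \<longrightarrow> f z = 0) \<and>
                       bloch_seminorm \<mu> f < \<infinity>}"

definition bloch_norm :: "(complex \<Rightarrow> real) \<Rightarrow> (complex \<Rightarrow> complex) \<Rightarrow> real" where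
  "bloch_norm \<mu> f = cmod (f 0) + enn2real (bloch_seminorm \<mu> f)"

definition bloch_dist :: "(complex \<Rightarrow> real) \<Rightarrow> (complex \<Rightarrow> complex) \<Rightarrow> (complex \<Rightarrow> complex) \<Rightarrow> real" where
  "bloch_dist \<mu> f g = bloch_norm \<mu> (\<lambda>z. f z - g z)"

definition bloch_topology :: "(complex \<Rightarrow> real) \<Rightarrow> (complex \<Rightarrow> complex) topology" where
  "bloch_topology \<mu> = Metric_space.mtopology (bloch_space \<mu>) (bloch_dist \<mu>)"

definition bloch_unit_ball :: "(complex \<Rightarrow> real) \<Rightarrow> (complex \<Rightarrow> complex) set" where
  "bloch_unit_ball \<mu> = {f \<in> bloch_space \<mu>. bloch_norm \<mu> f \<le> 1}"

type_synonym operator = "(complex \<Rightarrow> complex) \<Rightarrow> (complex \<Rightarrow> complex)"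

(* In the following definitions the operator acts from the Bloch space of the first weight to
   that of the second; its values off the domain space are irrelevant. *)
definition linear_op :: "(complex \<Rightarrow> real) \<Rightarrow> (complex \<Rightarrow> real) \<Rightarrow> operator \<Rightarrow> bool" where
  "linear_op \<mu> \<nu> T \<longleftrightarrow>
     (\<forall>f\<in>bloch_space \<mu>. T f \<in> bloch_space \<nu>) \<and>
     (\<forall>f\<in>bloch_space \<mu>. \<forall>g\<in>bloch_space \<mu>. T (\<lambda>z. f z + g z) = (\<lambda>z. T f z + T g z)) \<and>
     (\<forall>c. \<forall>f\<in>bloch_space \<mu>. T (\<lambda>z. c * f z) = (\<lambda>z. c * T f z))"

definition bounded_linear_op :: "(complex \<Rightarrow> real) \<Rightarrow> (complex \<Rightarrow> real) \<Rightarrow> operator \<Rightarrow> bool" where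
  "bounded_linear_op \<mu> \<nu> T \<longleftrightarrow> linear_op \<mu> \<nu> T \<and>
     (\<exists>C. \<forall>f\<in>bloch_space \<mu>. bloch_norm \<nu> (T f) \<le> C * bloch_norm \<mu> f)"

definition compact_linear_op :: "(complex \<Rightarrow> real) \<Rightarrow> (complex \<Rightarrow> real) \<Rightarrow> operator \<Rightarrow> bool" where
  "compact_linear_op \<mu> \<nu> T \<longleftrightarrow> linear_op \<mu> \<nu> T \<and>
     compactin (bloch_topology \<nu>) (bloch_topology \<nu> closure_of (T ` bloch_unit_ball \<mu>))"

definition operator_norm :: "(complex \<Rightarrow> real) \<Rightarrow> (complex \<Rightarrow> real) \<Rightarrow> operator \<Rightarrow> ennreal" where
  "operator_norm \<mu> \<nu> T = (SUP f\<in>bloch_unit_ball \<mu>. ennreal (bloch_norm \<nu> (T f)))"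

definition essential_norm :: "(complex \<Rightarrow> real) \<Rightarrow> (complex \<Rightarrow> real) \<Rightarrow> operator \<Rightarrow> ennreal" where
  "essential_norm \<mu> \<nu> T =
     (INF K\<in>{K. compact_linear_op \<mu> \<nu> K}. operator_norm \<mu> \<nu> (\<lambda>f z. T f z - K f z))"

(* f \<circ> \<phi> on the disk, extended by 0 as required of elements of a Bloch space. *)
definition composition_op :: "(complex \<Rightarrow> complex) \<Rightarrow> operator" where
  "composition_op \<phi> f = (\<lambda>z. if z \<in> unit_disk then f (\<phi> z) else 0)"

text \<open>
  The constants of locale \<^locale>\<open>Metric_space\<close> used in \<open>bloch_topology\<close> are meaningful only for an actual
  metric space; the following facts establish this for every weight, and that \<open>v_log\<close> is a weight.
\<close>

lemma bloch_seminorm_add_le: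
  assumes "weight \<mu>" "f holomorphic_on unit_disk" "g holomorphic_on unit_disk"
  shows "bloch_seminorm \<mu> (\<lambda>z. f z + g z) \<le> bloch_seminorm \<mu> f + bloch_seminorm \<mu> g"
  unfolding bloch_seminorm_def
proof (rule SUP_least)
  fix z :: complex assume z: "z \<in> unit_disk"
  have p: "0 < \<mu> z" using assms(1) z by (auto simp: weight_def)
  have "deriv (\<lambda>z. f z + g z) z = deriv f z + deriv g z"
    using assms(2,3) z by (intro deriv_add) (auto intro: holomorphic_on_imp_differentiable_at)
  hence "\<mu> z * cmod (deriv (\<lambda>z. f z + g z) z) \<le> \<mu> z * cmod (deriv f z) + \<mu> z * cmod (deriv g z)"
    using p by (simp add: norm_triangle_ineq flip: distrib_left)
  hence "ennreal (\<mu> z * cmod (deriv (\<lambda>z. f z + g z) z)) \<le> ennreal (\<mu> z * cmod (deriv f z)) + ennreal (\<mu> z * cmod (deriv g z))"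
    using p by (simp add: ennreal_leI flip: ennreal_plus)
  also have "\<dots> \<le> (SUP z\<in>unit_disk. ennreal (\<mu> z * cmod (deriv f z))) + (SUP z\<in>unit_disk. ennreal (\<mu> z * cmod (deriv g z)))"
    using z by (intro add_mono SUP_upper)
  finally show "ennreal (\<mu> z * cmod (deriv (\<lambda>z. f z + g z) z)) \<le> \<dots>" .
qed

lemma bloch_seminorm_minus:
  assumes "f holomorphic_on unit_disk"
  shows "bloch_seminorm \<mu> (\<lambda>z. - f z) = bloch_seminorm \<mu> f"
  unfolding bloch_seminorm_def
  using assms by (intro SUP_cong refl) (auto simp: deriv_minus holomorphic_on_imp_differentiable_at)

lemma bloch_space_diff:
  assumes "weight \<mu>" "f \<in> bloch_space \<mu>" "g \<in> bloch_space \<mu>"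
  shows "(\<lambda>z. f z - g z) \<in> bloch_space \<mu>"
proof -
  have h: "f holomorphic_on unit_disk" "g holomorphic_on unit_disk" "(\<lambda>z. - g z) holomorphic_on unit_disk"
    using assms by (auto simp: bloch_space_def intro: holomorphic_intros)
  show ?thesis
    using bloch_seminorm_add_le[OF assms(1) h(1) h(3)] bloch_seminorm_minus[OF h(2), of \<mu>] assms h
    by (auto simp: bloch_space_def intro!: holomorphic_intros elim: le_less_trans)
qed

lemma bloch_norm_definite:
  assumes "weight \<mu>" "f \<in> bloch_space \<mu>"
  shows "bloch_norm \<mu> f = 0 \<longleftrightarrow> f = (\<lambda>z. 0)"
proof
  assume 0: "bloch_norm \<mu> f = 0"
  have f: "f holomorphic_on unit_disk" "\<And>z. z \<notin> unit_disk \<Longrightarrow> f z = 0" "bloch_seminorm \<mu> f < \<infinity>"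
    using assms(2) by (auto simp: bloch_space_def)
  from 0 have n: "f 0 = 0" "enn2real (bloch_seminorm \<mu> f) = 0"
    unfolding bloch_norm_def using enn2real_nonneg[of "bloch_seminorm \<mu> f"] norm_ge_zero[of "f 0"]
    by (smt (verit) norm_eq_zero)+
  have s: "bloch_seminorm \<mu> f = 0" using n(2) f(3) by (auto simp: enn2real_eq_0_iff)
  have d: "deriv f z = 0" if "z \<in> unit_disk" for z
  proof -
    have "ennreal (\<mu> z * cmod (deriv f z)) \<le> bloch_seminorm \<mu> f"
      unfolding bloch_seminorm_def using that by (rule SUP_upper)
    moreover have "0 < \<mu> z" using assms(1) that by (auto simp: weight_def)
    ultimately show ?thesis using s by (auto simp: ennreal_eq_0_iff mult_le_0_iff)
  qed
  have "\<exists>c. \<forall>z\<in>unit_disk. f z = c"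
  proof (rule has_field_derivative_zero_constant)
    fix z :: complex assume "z \<in> unit_disk"
    thus "(f has_field_derivative 0) (at z within unit_disk)"
      using d[of z] holomorphic_derivI[OF f(1) open_ball, of z] by (metis has_field_derivative_at_within)
  qed simp
  thus "f = (\<lambda>z. 0)" using n(1) f(2)
    by (metis centre_in_ball zero_less_one ext)
next
  assume "f = (\<lambda>z. 0)" thus "bloch_norm \<mu> f = 0" by (simp add: bloch_norm_def bloch_seminorm_def zero_ennreal_def[symmetric])
qed

lemma Metric_space_bloch:
  assumes "weight \<mu>"
  shows "Metric_space (bloch_space \<mu>) (bloch_dist \<mu>)"
proof
  fix f g :: "complex \<Rightarrow> complex"
  show "0 \<le> bloch_dist \<mu> f g" by (simp add: bloch_dist_def bloch_norm_def)
next
  fix f g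
  show "bloch_dist \<mu> f g = bloch_dist \<mu> g f"
  proof -
    have "cmod (deriv (\<lambda>z. f z - g z) w) = cmod (deriv (\<lambda>z. g z - f z) w)" for w
    proof (cases "(\<lambda>z. f z - g z) field_differentiable at w")
      case True
      from deriv_minus[OF this] show ?thesis by simp
    next
      case False
      hence "\<not> (\<lambda>z. g z - f z) field_differentiable at w"
        using field_differentiable_minus[of "\<lambda>z. g z - f z" "at w"] by auto
      with False have "(\<lambda>D. ((\<lambda>z. f z - g z) has_field_derivative D) (at w)) =
                       (\<lambda>D. ((\<lambda>z. g z - f z) has_field_derivative D) (at w))"
        by (auto simp: field_differentiable_def)
      thus ?thesis by (simp add: deriv_def)
    qed
    thus ?thesis by (simp add: bloch_dist_def bloch_norm_def bloch_seminorm_def norm_minus_commute)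
  qed
next
  fix f g assume "f \<in> bloch_space \<mu>" "g \<in> bloch_space \<mu>"
  thus "bloch_dist \<mu> f g = 0 \<longleftrightarrow> f = g"
    using bloch_norm_definite[OF assms bloch_space_diff[OF assms]] by (auto simp: bloch_dist_def fun_eq_iff)
next
  fix f g h assume a: "f \<in> bloch_space \<mu>" "g \<in> bloch_space \<mu>" "h \<in> bloch_space \<mu>"
  let ?a = "\<lambda>z. f z - g z" and ?b = "\<lambda>z. g z - h z"
  have m: "?a \<in> bloch_space \<mu>" "?b \<in> bloch_space \<mu>" using a bloch_space_diff[OF assms] by auto
  have "bloch_seminorm \<mu> (\<lambda>z. ?a z + ?b z) \<le> bloch_seminorm \<mu> ?a + bloch_seminorm \<mu> ?b"
    using m by (intro bloch_seminorm_add_le assms) (auto simp: bloch_space_def)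
  hence "enn2real (bloch_seminorm \<mu> (\<lambda>z. f z - h z)) \<le> enn2real (bloch_seminorm \<mu> ?a + bloch_seminorm \<mu> ?b)"
    using m by (intro enn2real_mono) (auto simp: bloch_space_def)
  also have "\<dots> = enn2real (bloch_seminorm \<mu> ?a) + enn2real (bloch_seminorm \<mu> ?b)"
    using m by (intro enn2real_plus) (auto simp: bloch_space_def)
  finally show "bloch_dist \<mu> f h \<le> bloch_dist \<mu> f g + bloch_dist \<mu> g h"
    using norm_triangle_ineq[of "f 0 - g 0" "g 0 - h 0"] by (simp add: bloch_dist_def bloch_norm_def)
qed

lemma weight_v_log: "weight v_log"
  unfolding weight_def
proof (intro conjI ballI)
  show "continuous_on unit_disk v_log"
    unfolding v_log_def by (intro continuous_intros) auto
  have b: "0 < v_log z \<and> v_log z \<le> 3" if "z \<in> unit_disk" for z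
  proof -
    define t where "t = 1 - cmod z"
    have t: "0 < t" "t \<le> 1" using that by (auto simp: t_def)
    have "0 < ln (3 / t)" "ln (3 / t) \<le> 3 / t"
      using t ln_le_minus_one[of "3 / t"] by (auto intro!: ln_gt_zero simp: field_simps)
    hence "0 < t * ln (3 / t) \<and> t * ln (3 / t) \<le> 3"
      using t by (simp add: pos_le_divide_eq mult.commute)
    thus ?thesis by (simp only: v_log_def t_def)
  qed
  thus "bounded (v_log ` unit_disk)" by (intro boundedI[of _ 3]) (force simp: abs_of_pos)
  show "0 < v_log z" if "z \<in> unit_disk" for z using b that by blast
qed

end

theory Submission
  imports Defs
begin

text \<open>
  Both inequalities hold with \<open>K = 13\<close>; the second one even with constant 1.

  For the upper estimate of the limit superior, test the operator on the monomials normalised in the log-Bloch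
  seminorm, which the composition operator \<open>C\<close> sends to multiples of the powers of \<open>\<phi>\<close>. A compact operator \<open>T\<close> sends
  them to 0 (\<open>compact_op_unit_monomial_small\<close>), so \<open>C - T\<close> is at least as large as the limit superior. The reason is
  that the weighted derivative of a normalised monomial of high degree lives in a thin annulus close to the circle: sums
  of \<open>k\<close> such monomials with sparse degrees have bounded norm (\<open>sparse_monomials\<close>), so their averages tend to 0 in norm,
  whereas averages of vectors that accumulate at a nonzero vector do not.

  For the upper estimate of the essential norm, let \<open>c\<close> exceed the limit superior. The seminorm of the monomial of
  degree \<open>j\<close> is comparable to \<open>ln (3 * j)\<close>, and it is attained, up to a factor 4, at the points with \<open>1 - |w|\<close> about
  \<open>1 / (2 * j)\<close>. Choosing \<open>j\<close> according to \<open>\<phi> z\<close> yields the pointwise bound \<open>\<mu> z * |\<phi>' z| \<le> 4 * c * v_log (\<phi> z)\<close>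
  whenever \<open>\<phi> z\<close> is close to the circle (\<open>hyperbolic_derivative_bound\<close>). Now subtract from \<open>C\<close> the operator that first
  replaces \<open>f\<close> by a Taylor polynomial of a dilation of \<open>f\<close>. It has finite rank, hence is compact. What remains of \<open>f\<close> is,
  uniformly over the unit ball, small on a large disk and bounded in norm near the circle (\<open>taylor_approximation\<close>),
  where the pointwise bound takes over (\<open>essential_norm_le\<close>).
\<close>

section \<open>Norms and linear operators on Bloch spaces\<close>

lemma bloch_seminorm_cong:
  assumes "\<And>z. z \<in> unit_disk \<Longrightarrow> f z = g z"
  shows "bloch_seminorm \<mu> f = bloch_seminorm \<mu> g"
proof -
  have "deriv f z = deriv g z" if "z \<in> unit_disk" for z
    using assms eventually_nhds_in_open[OF open_ball that]
    by (intro deriv_cong_ev) (auto elim: eventually_mono)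
  thus ?thesis unfolding bloch_seminorm_def by (intro SUP_cong) auto
qed

lemma bloch_seminorm_le:
  assumes "\<And>z. z \<in> unit_disk \<Longrightarrow> \<mu> z * cmod (deriv f z) \<le> C"
  shows "bloch_seminorm \<mu> f \<le> ennreal C"
  unfolding bloch_seminorm_def using assms by (intro SUP_least ennreal_leI)

lemma bloch_seminorm_upper:
  assumes "z \<in> unit_disk"
  shows "ennreal (\<mu> z * cmod (deriv f z)) \<le> bloch_seminorm \<mu> f"
  unfolding bloch_seminorm_def using assms by (rule SUP_upper)

lemma deriv_le_bloch_seminorm:
  assumes "bloch_seminorm \<mu> f < \<infinity>" "z \<in> unit_disk"
  shows "\<mu> z * cmod (deriv f z) \<le> enn2real (bloch_seminorm \<mu> f)"
proof -
  have "ennreal (\<mu> z * cmod (deriv f z)) \<le> ennreal (enn2real (bloch_seminorm \<mu> f))"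
    using bloch_seminorm_upper[OF assms(2), of \<mu> f] assms(1) by (simp add: less_top)
  thus ?thesis by (auto simp: ennreal_le_iff2 intro: order_trans)
qed

lemma bloch_spaceI:
  assumes "f holomorphic_on unit_disk" "\<And>z. z \<notin> unit_disk \<Longrightarrow> f z = 0"
    and "\<And>z. z \<in> unit_disk \<Longrightarrow> \<mu> z * cmod (deriv f z) \<le> C"
  shows "f \<in> bloch_space \<mu>"
  using assms bloch_seminorm_le[of \<mu> f C]
  by (auto simp: bloch_space_def less_top intro: le_less_trans)

lemma bloch_norm_le:
  assumes "\<And>z. z \<in> unit_disk \<Longrightarrow> \<mu> z * cmod (deriv f z) \<le> C" "0 \<le> C"
  shows "bloch_norm \<mu> f \<le> cmod (f 0) + C"
  using enn2real_mono[OF bloch_seminorm_le[of \<mu> f C]] assms by (simp add: bloch_norm_def)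

lemma bloch_norm_nonneg [simp]: "0 \<le> bloch_norm \<mu> f"
  by (simp add: bloch_norm_def)

lemma deriv_le_bloch_norm:
  assumes "f \<in> bloch_space \<mu>" "z \<in> unit_disk"
  shows "\<mu> z * cmod (deriv f z) \<le> bloch_norm \<mu> f"
  using deriv_le_bloch_seminorm[of \<mu> f z] assms
  by (auto simp: bloch_space_def bloch_norm_def intro: order_trans)

lemma bloch_space_holomorphic: "f \<in> bloch_space \<mu> \<Longrightarrow> f holomorphic_on unit_disk"
  by (simp add: bloch_space_def)

lemma bloch_space_zero: "(\<lambda>z. 0) \<in> bloch_space \<mu>"
  by (rule bloch_spaceI[where C = 0]) auto

lemma bloch_norm_zero [simp]: "bloch_norm \<mu> (\<lambda>z. 0) = 0"
  using bloch_norm_le[of \<mu> "\<lambda>z. 0" 0] bloch_norm_nonneg[of \<mu> "\<lambda>z. 0"] by simp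

lemma bloch_space_scale_and_norm:
  assumes "f \<in> bloch_space \<mu>"
  shows "(\<lambda>z. c * f z) \<in> bloch_space \<mu>" "bloch_norm \<mu> (\<lambda>z. c * f z) \<le> cmod c * bloch_norm \<mu> f"
proof -
  have hol: "f holomorphic_on unit_disk" using assms by (simp add: bloch_space_def)
  have *: "\<mu> z * cmod (deriv (\<lambda>z. c * f z) z) \<le> cmod c * enn2real (bloch_seminorm \<mu> f)"
    if z: "z \<in> unit_disk" for z
  proof -
    have "deriv (\<lambda>z. c * f z) z = c * deriv f z"
      using hol z by (intro deriv_cmult holomorphic_on_imp_differentiable_at) auto
    thus ?thesis
      using mult_left_mono[OF deriv_le_bloch_seminorm[of \<mu> f z], of "cmod c"] assms z
      by (auto simp: norm_mult bloch_space_def algebra_simps)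
  qed
  show "(\<lambda>z. c * f z) \<in> bloch_space \<mu>"
    using hol assms by (intro bloch_spaceI[OF _ _ *]) (auto intro!: holomorphic_intros simp: bloch_space_def)
  show "bloch_norm \<mu> (\<lambda>z. c * f z) \<le> cmod c * bloch_norm \<mu> f"
    using bloch_norm_le[OF *] by (simp add: bloch_norm_def norm_mult algebra_simps)
qed

lemma bloch_space_add_and_norm:
  assumes "weight \<mu>" "f \<in> bloch_space \<mu>" "g \<in> bloch_space \<mu>"
  shows "(\<lambda>z. f z + g z) \<in> bloch_space \<mu>"
    "bloch_norm \<mu> (\<lambda>z. f z + g z) \<le> bloch_norm \<mu> f + bloch_norm \<mu> g"
proof -
  have hol: "f holomorphic_on unit_disk" "g holomorphic_on unit_disk"
    using assms by (auto simp: bloch_space_def)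
  have *: "\<mu> z * cmod (deriv (\<lambda>z. f z + g z) z)
             \<le> enn2real (bloch_seminorm \<mu> f) + enn2real (bloch_seminorm \<mu> g)"
    if z: "z \<in> unit_disk" for z
  proof -
    have "deriv (\<lambda>z. f z + g z) z = deriv f z + deriv g z"
      using hol z by (intro deriv_add holomorphic_on_imp_differentiable_at) auto
    moreover have "0 < \<mu> z" using assms(1) z by (auto simp: weight_def)
    ultimately have "\<mu> z * cmod (deriv (\<lambda>z. f z + g z) z)
         \<le> \<mu> z * cmod (deriv f z) + \<mu> z * cmod (deriv g z)"
      by (simp add: norm_triangle_ineq flip: distrib_left)
    thus ?thesis
      using deriv_le_bloch_seminorm[of \<mu> f z] deriv_le_bloch_seminorm[of \<mu> g z] assms z
      by (auto simp: bloch_space_def)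
  qed
  show "(\<lambda>z. f z + g z) \<in> bloch_space \<mu>"
    using hol assms by (intro bloch_spaceI[OF _ _ *]) (auto intro!: holomorphic_intros simp: bloch_space_def)
  show "bloch_norm \<mu> (\<lambda>z. f z + g z) \<le> bloch_norm \<mu> f + bloch_norm \<mu> g"
    using bloch_norm_le[OF *] norm_triangle_ineq[of "f 0" "g 0"] by (simp add: bloch_norm_def)
qed

lemma bloch_norm_triangle_diff:
  assumes "weight \<mu>" "f \<in> bloch_space \<mu>" "g \<in> bloch_space \<mu>"
  shows "bloch_norm \<mu> f \<le> bloch_norm \<mu> (\<lambda>z. f z - g z) + bloch_norm \<mu> g"
  using bloch_space_add_and_norm(2)[OF assms(1) bloch_space_diff[OF assms] assms(3)] by simp

lemma bloch_space_sum:
  assumes "weight \<mu>" "\<And>i. i \<in> A \<Longrightarrow> f i \<in> bloch_space \<mu>"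
  shows "(\<lambda>z. \<Sum>i\<in>A. f i z) \<in> bloch_space \<mu>"
  using assms(2)
  by (induction A rule: infinite_finite_induct)
     (auto intro: bloch_space_add_and_norm[OF assms(1)] bloch_space_zero)

lemma bloch_norm_sum_le:
  assumes "weight \<mu>" "\<And>i. i \<in> A \<Longrightarrow> f i \<in> bloch_space \<mu>"
  shows "bloch_norm \<mu> (\<lambda>z. \<Sum>i\<in>A. f i z) \<le> (\<Sum>i\<in>A. bloch_norm \<mu> (f i))"
  using assms(2)
proof (induction A rule: infinite_finite_induct)
  case (insert i A)
  have "bloch_norm \<mu> (\<lambda>z. f i z + (\<Sum>i\<in>A. f i z)) \<le> bloch_norm \<mu> (f i) + bloch_norm \<mu> (\<lambda>z. \<Sum>i\<in>A. f i z)"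
    using insert by (intro bloch_space_add_and_norm(2) bloch_space_sum assms(1)) auto
  with insert show ?case by fastforce
qed auto

lemma linear_op_closed: "linear_op \<mu> \<nu> T \<Longrightarrow> f \<in> bloch_space \<mu> \<Longrightarrow> T f \<in> bloch_space \<nu>"
  by (simp add: linear_op_def)

lemma linear_op_scale:
  "linear_op \<mu> \<nu> T \<Longrightarrow> f \<in> bloch_space \<mu> \<Longrightarrow> T (\<lambda>z. c * f z) = (\<lambda>z. c * T f z)"
  unfolding linear_op_def by blast

lemma linear_op_add:
  "linear_op \<mu> \<nu> T \<Longrightarrow> f \<in> bloch_space \<mu> \<Longrightarrow> g \<in> bloch_space \<mu>
     \<Longrightarrow> T (\<lambda>z. f z + g z) = (\<lambda>z. T f z + T g z)"
  unfolding linear_op_def by blast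

lemma linear_op_zero: "linear_op \<mu> \<nu> T \<Longrightarrow> T (\<lambda>z. 0) = (\<lambda>z. 0)"
  using linear_op_scale[of \<mu> \<nu> T "\<lambda>z. 0" 0] by (simp add: bloch_space_zero)

lemma linear_op_sum:
  assumes \<mu>: "weight \<mu>" and T: "linear_op \<mu> \<nu> T" and "\<And>i. i \<in> A \<Longrightarrow> f i \<in> bloch_space \<mu>"
  shows "T (\<lambda>z. \<Sum>i\<in>A. f i z) = (\<lambda>z. \<Sum>i\<in>A. T (f i) z)"
  using assms(3)
proof (induction A rule: infinite_finite_induct)
  case (insert i A)
  have "T (\<lambda>z. f i z + (\<Sum>i\<in>A. f i z)) = (\<lambda>z. T (f i) z + T (\<lambda>z. \<Sum>i\<in>A. f i z) z)"
    using insert bloch_space_sum[OF \<mu>, of A f] by (intro linear_op_add[OF T]) auto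
  thus ?case using insert by simp
qed (simp_all add: linear_op_zero[OF T])

section \<open>The logarithmic weight and monomials\<close>

text \<open>Since \<open>ln x \<le> x - 1\<close>, passing from \<open>t\<close> to \<open>s\<close> raises the logarithm by at most \<open>(t - s) / s\<close>, which costs
  \<open>t - s\<close> after multiplication by \<open>s\<close>. The gain is \<open>(t - s) * ln (3 / t)\<close>, and \<open>ln (3 / t) \<ge> 1\<close> because \<open>3 \<ge> exp 1\<close>:
  this is what the constant 3 in the weight is good for.\<close>

lemma times_ln_mono:
  fixes s t :: real
  assumes "0 < s" "s \<le> t" "t \<le> 1"
  shows "s * ln (3 / s) \<le> t * ln (3 / t)"
proof -
  have "ln (t / s) \<le> t / s - 1" using assms by (intro ln_le_minus_one) auto
  hence "s * ln (t / s) \<le> t - s" using assms by (simp add: field_simps)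
  moreover have "ln (3 / s) = ln (3 / t) + ln (t / s)"
    using assms by (simp add: ln_div)
  moreover have "1 \<le> ln (3 / t)"
  proof -
    have "exp 1 \<le> (3 :: real)" by (rule exp_le)
    also have "3 \<le> 3 / t" using assms by (simp add: field_simps)
    finally show ?thesis using assms by (simp add: ln_ge_iff)
  qed
  hence "(t - s) * 1 \<le> (t - s) * ln (3 / t)" using assms by (intro mult_left_mono) auto
  ultimately show ?thesis by (simp add: algebra_simps)
qed

lemma v_log_pos: "cmod z < 1 \<Longrightarrow> 0 < v_log z"
  using weight_v_log by (auto simp: weight_def)

lemma v_log_antimono: "cmod z \<le> cmod w \<Longrightarrow> cmod w < 1 \<Longrightarrow> v_log w \<le> v_log z"
  unfolding v_log_def by (rule times_ln_mono) auto

lemma v_log_le_2: "cmod z < 1 \<Longrightarrow> v_log z \<le> 2"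
  using v_log_antimono[of 0 z] ln_le_minus_one[of 3] by (simp add: v_log_def)

definition monomial_norm :: "nat \<Rightarrow> real" where
  "monomial_norm j = enn2real (bloch_seminorm v_log (\<lambda>z. z ^ j))"

text \<open>With \<open>s = 1 - |z|\<close>, the quantity is \<open>j * (1 - s) ^ (j - 1) * s * ln (3 / s)\<close>. For \<open>s \<le> 1 / j\<close> monotonicity of
  \<open>s * ln (3 / s)\<close> reduces it to \<open>s = 1 / j\<close>; for larger \<open>s\<close> the logarithm is at most \<open>ln (3 * j)\<close> and the remaining
  factor is at most 1 by a geometric sum.\<close>

lemma v_log_deriv_monomial_le:
  assumes "1 \<le> j" "cmod z < 1"
  shows "v_log z * (real j * cmod z ^ (j - 1)) \<le> ln (3 * real j)"
proof -
  define s where "s = 1 - cmod z"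
  have s: "0 < s" "s \<le> 1" and r: "cmod z = 1 - s" using assms by (auto simp: s_def)
  have j: "real j \<ge> 1" using assms by simp
  have pow: "(1 - s) ^ (j - 1) \<le> 1" "0 \<le> (1 - s) ^ (j - 1)" using s by (auto intro: power_le_one)
  show ?thesis
  proof (cases "s \<le> 1 / real j")
    case True
    have "s * ln (3 / s) \<le> 1 / real j * ln (3 / (1 / real j))"
      using s True j by (intro times_ln_mono) auto
    moreover have "real j * (1 - s) ^ (j - 1) \<le> real j"
      using pow j by (simp add: mult_left_le)
    moreover have "0 \<le> s * ln (3 / s)" using s by (intro mult_nonneg_nonneg ln_ge_zero) auto
    ultimately have "(s * ln (3 / s)) * (real j * (1 - s) ^ (j - 1)) \<le> (1 / real j * ln (3 / (1 / real j))) * real j"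
      using pow j by (intro mult_mono[where b = "1 / real j * ln (3 / (1 / real j))"]) simp_all
    also have "\<dots> = ln (3 * real j)" using j by simp
    finally show ?thesis by (simp add: v_log_def r)
  next
    case False
    hence "ln (3 / s) \<le> ln (3 * real j)" using s j by (simp add: field_simps)
    moreover have "real j * (1 - s) ^ (j - 1) * s \<le> 1"
    proof -
      \<comment> \<open>Bound each of the \<open>j\<close> equal terms by a term of the geometric series.\<close>
      have "real j * (1 - s) ^ (j - 1) = (\<Sum>i<j. (1 - s) ^ (j - 1))" by simp
      also have "\<dots> \<le> (\<Sum>i<j. (1 - s) ^ i)"
        using s by (intro sum_mono power_decreasing) auto
      finally have "real j * (1 - s) ^ (j - 1) * s \<le> (\<Sum>i<j. (1 - s) ^ i) * s"
        using s by (intro mult_right_mono) auto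
      also have "\<dots> = 1 - (1 - s) ^ j" using one_diff_power_eq[of "1 - s" j] by simp
      also have "\<dots> \<le> 1" using s by simp
      finally show ?thesis .
    qed
    moreover have "0 \<le> ln (3 / s)" "0 \<le> real j * (1 - s) ^ (j - 1) * s" using s by auto
    ultimately have "ln (3 / s) * (real j * (1 - s) ^ (j - 1) * s) \<le> ln (3 * real j) * 1"
      by (intro mult_mono) auto
    thus ?thesis by (simp add: v_log_def r mult_ac)
  qed
qed

text \<open>A monomial of degree about \<open>1 / (2 * (1 - |z|))\<close> attains its seminorm at \<open>z\<close> up to a factor 4: by Bernoulli's inequality
  \<open>|z| ^ (j - 1) \<ge> 1 / 2\<close>, and \<open>j\<close> times \<open>1 - |z|\<close> is at least \<open>1 / 2\<close>. Combined with the upper bound \<open>ln (3 * j)\<close> for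
  the seminorm, this turns information on the powers of a symbol into information at a single point.\<close>

lemma ln_le_v_log_deriv_monomial:
  assumes z: "cmod z < 1" "1 - cmod z \<le> 1 / 2"
    and j: "1 / (2 * (1 - cmod z)) \<le> real j" "real j \<le> 1 / (2 * (1 - cmod z)) + 1"
  shows "ln (3 * real j) \<le> 4 * (v_log z * (real j * cmod z ^ (j - 1)))"
proof -
  define t where "t = 1 - cmod z"
  have t: "0 < t" "t \<le> 1 / 2" and r: "cmod z = 1 - t" using z by (auto simp: t_def)
  have j': "1 / (2 * t) \<le> real j" "real j \<le> 1 / (2 * t) + 1" using j by (auto simp: t_def)
  have "0 < real j" using j'(1) t by (intro less_le_trans[OF _ j'(1)]) auto
  hence j1: "1 \<le> j" by simp
  have "real (j - 1) * t \<le> 1 / 2"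
  proof -
    have "real (j - 1) \<le> 1 / (2 * t)" using j' j1 by (simp add: of_nat_diff)
    thus ?thesis using t by (simp add: field_simps)
  qed
  moreover have "1 + real (j - 1) * (- t) \<le> (1 + (- t)) ^ (j - 1)"
    using t by (intro Bernoulli_inequality) auto
  ultimately have pow: "1 / 2 \<le> (1 - t) ^ (j - 1)" by simp
  have jt: "1 / 2 \<le> real j * t" using j'(1) t by (simp add: field_simps)
  have "real j \<le> 1 / t"
  proof -
    have "1 / (2 * t) + 1 \<le> 1 / t" using t by (simp add: field_simps)
    with j' show ?thesis by simp
  qed
  hence "ln (3 * real j) \<le> ln (3 / t)" using t j1 by (simp add: field_simps)
  also have "\<dots> = 4 * (ln (3 / t) * (1 / 2 * (1 / 2)))" by simp
  also have "\<dots> \<le> 4 * (ln (3 / t) * ((real j * t) * (1 - t) ^ (j - 1)))"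
    using pow jt t by (intro mult_left_mono mult_mono) auto
  finally show ?thesis by (simp add: v_log_def r mult_ac)
qed

lemma deriv_monomial: "deriv (\<lambda>z::complex. z ^ j) z = of_nat j * z ^ (j - 1)"
  by (rule DERIV_imp_deriv) (auto intro!: derivative_eq_intros)

lemma bloch_seminorm_monomial_le:
  assumes "1 \<le> j"
  shows "bloch_seminorm v_log (\<lambda>z. z ^ j) \<le> ennreal (ln (3 * real j))"
  using v_log_deriv_monomial_le[OF assms]
  by (intro bloch_seminorm_le) (auto simp: deriv_monomial norm_mult norm_power)

lemma bloch_seminorm_monomial:
  assumes "1 \<le> j"
  shows "bloch_seminorm v_log (\<lambda>z. z ^ j) = ennreal (monomial_norm j)"
proof -
  have "bloch_seminorm v_log (\<lambda>z. z ^ j) < top"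
    using bloch_seminorm_monomial_le[OF assms] ennreal_less_top by (rule le_less_trans)
  thus ?thesis by (simp add: monomial_norm_def)
qed

lemma monomial_norm_le:
  assumes "1 \<le> j"
  shows "monomial_norm j \<le> ln (3 * real j)"
proof -
  have "ennreal (monomial_norm j) \<le> ennreal (ln (3 * real j))"
    using bloch_seminorm_monomial_le[OF assms] bloch_seminorm_monomial[OF assms] by metis
  moreover have "0 \<le> ln (3 * real j)" using assms by (intro ln_ge_zero) simp
  ultimately show ?thesis by (subst (asm) ennreal_le_iff)
qed

lemma le_monomial_norm:
  assumes "1 \<le> j" "cmod z < 1"
  shows "v_log z * (real j * cmod z ^ (j - 1)) \<le> monomial_norm j"
proof -
  have "bloch_seminorm v_log (\<lambda>z. z ^ j) < \<infinity>"
    by (simp add: bloch_seminorm_monomial[OF assms(1)])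
  from deriv_le_bloch_seminorm[OF this, of z] show ?thesis
    using assms(2) by (simp add: deriv_monomial norm_mult norm_power monomial_norm_def)
qed

lemma monomial_norm_ge:
  assumes "1 \<le> j"
  shows "1 / 4 \<le> monomial_norm j"
proof -
  \<comment> \<open>Here \<open>j = 1 / (2 * (1 - |z|))\<close>, so the degree is adapted to the point.\<close>
  define z where "z = complex_of_real (1 - 1 / (2 * real j))"
  have "1 / (2 * real j) \<le> 1 / 2" using assms by simp
  hence z: "cmod z = 1 - 1 / (2 * real j)" by (simp add: z_def del: of_real_diff)
  have "ln (3 * real j) \<le> 4 * (v_log z * (real j * cmod z ^ (j - 1)))"
    using assms by (intro ln_le_v_log_deriv_monomial) (auto simp: z)
  also have "\<dots> \<le> 4 * monomial_norm j"
    using assms le_monomial_norm[of j z] by (simp add: z)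
  finally have "ln (3 * real j) \<le> 4 * monomial_norm j" .
  moreover have "1 \<le> ln (3 * real j)"
  proof -
    have "exp 1 \<le> (3 :: real)" by (rule exp_le)
    also have "3 \<le> 3 * real j" using assms by simp
    finally show ?thesis using assms by (simp add: ln_ge_iff)
  qed
  ultimately show ?thesis by linarith
qed

text \<open>The radial function \<open>v_log z * |f' z|\<close> for the monomial \<open>f\<close> of degree \<open>j\<close>, normalised to have supremum at most 1.
  It concentrates in a thin annulus that moves to the boundary as \<open>j\<close> grows.\<close>

definition monomial_profile :: "nat \<Rightarrow> real \<Rightarrow> real" where
  "monomial_profile j r = (1 - r) * ln (3 / (1 - r)) * (real j * r ^ (j - 1)) / monomial_norm j"

lemma monomial_profile_eq:
  "monomial_profile j (cmod z) = v_log z * (real j * cmod z ^ (j - 1)) / monomial_norm j"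
  unfolding monomial_profile_def v_log_def ..

lemma monomial_profile_le_1:
  assumes "1 \<le> j" "0 \<le> r" "r < 1"
  shows "monomial_profile j r \<le> 1"
proof -
  have c: "cmod (complex_of_real r) = r" using assms by simp
  have "(1 - r) * ln (3 / (1 - r)) * (real j * r ^ (j - 1)) \<le> monomial_norm j"
    using le_monomial_norm[of j "complex_of_real r", unfolded v_log_def c] assms by blast
  moreover have "0 < monomial_norm j" using monomial_norm_ge[OF assms(1)] by linarith
  ultimately show ?thesis unfolding monomial_profile_def by (simp only: divide_le_eq_1_pos)
qed

lemma monomial_profile_tendsto_0: "(monomial_profile j \<longlongrightarrow> 0) (at_left 1)"
proof -
  have lim: "((\<lambda>r::real. (1 - r) * ln (3 / (1 - r))) \<longlongrightarrow> 0) (at_left 1)"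
    by real_asymp
  have pow: "((\<lambda>r::real. real j * r ^ (j - 1)) \<longlongrightarrow> real j * 1 ^ (j - 1)) (at_left 1)"
    by (intro tendsto_mult tendsto_power tendsto_const tendsto_ident_at)
  have "((\<lambda>r. (1 - r) * ln (3 / (1 - r)) * (real j * r ^ (j - 1)) * (1 / monomial_norm j))
      \<longlongrightarrow> 0 * (real j * 1 ^ (j - 1)) * (1 / monomial_norm j)) (at_left 1)"
    by (rule tendsto_mult[OF tendsto_mult[OF lim pow] tendsto_const])
  thus ?thesis by (simp add: monomial_profile_def[abs_def])
qed

lemma monomial_profile_uniform_small:
  assumes "0 < R" "R < 1" "0 < \<eta>"
  shows "\<forall>\<^sub>F j in sequentially. \<forall>r\<in>{0..R}. monomial_profile j r \<le> \<eta>"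
proof -
  have "(\<lambda>j. real j * R ^ j * (8 / R)) \<longlonglongrightarrow> 0 * (8 / R)"
    using powser_times_n_limit_0[of R] assms by (intro tendsto_intros) auto
  hence "\<forall>\<^sub>F j in sequentially. real j * R ^ j * (8 / R) < \<eta>"
    using assms by (intro order_tendstoD(2)) auto
  moreover have "\<forall>\<^sub>F j in sequentially. 1 \<le> (j::nat)" by (rule eventually_ge_at_top)
  ultimately show ?thesis
  proof eventually_elim
    case (elim j)
    show ?case
    proof
      fix r assume r: "r \<in> {0..R}"
      have F: "1 / 4 \<le> monomial_norm j" using elim by (intro monomial_norm_ge)
      define L where "L = (1 - r) * ln (3 / (1 - r))"
      have c: "cmod (complex_of_real r) = r" "cmod (complex_of_real r) < 1" using r assms by auto
      have L: "L \<le> 2" "0 \<le> L"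
        using v_log_le_2[OF c(2)] less_imp_le[OF v_log_pos[OF c(2)]] unfolding v_log_def c(1) L_def by blast+
      have h: "real j * r ^ (j - 1) \<le> real j * R ^ (j - 1)" "0 \<le> real j * r ^ (j - 1)"
        using r by (auto intro!: mult_left_mono power_mono)
      have "L * (real j * r ^ (j - 1)) \<le> 2 * (real j * R ^ (j - 1))"
        by (rule mult_mono[OF L(1) h(1) _ h(2)]) simp
      moreover have "0 \<le> 2 * (real j * R ^ (j - 1))" using assms by simp
      ultimately have "monomial_profile j r \<le> 2 * (real j * R ^ (j - 1)) / (1 / 4)"
        unfolding monomial_profile_def L_def[symmetric] using F by (intro frac_le) linarith+
      also have "\<dots> = real j * R ^ j * (8 / R)"
        using elim(2) assms(1,2) by (simp add: power_eq_if)
      also have "\<dots> \<le> \<eta>" using elim(1) by (rule less_imp_le)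
      finally show "monomial_profile j r \<le> \<eta>" .
    qed
  qed
qed

text \<open>A gliding hump. Each profile vanishes at the boundary, and on each smaller disk the profiles of high degree
  are uniformly small. So a next degree can be chosen for which the old sum is below \<open>\<eta>\<close> wherever the new profile is
  not, so that the supremum of the sum exceeds the larger of 1 and its previous value by at most \<open>\<eta>\<close>.\<close>

lemma sparse_monomials:
  assumes J: "infinite J" and \<eta>: "0 < \<eta>"
  shows "\<exists>A\<subseteq>J. finite A \<and> card A = k \<and>
           (\<forall>r\<in>{0..<1}. (\<Sum>j\<in>A. monomial_profile j r) \<le> 1 + real k * \<eta>)"
proof (induction k)
  case 0
  show ?case by (intro exI[of _ "{}"]) auto
next
  case (Suc k)
  then obtain A where A: "A \<subseteq> J" "finite A" "card A = k"
    and bound: "\<And>r. r \<in> {0..<1} \<Longrightarrow> (\<Sum>j\<in>A. monomial_profile j r) \<le> 1 + real k * \<eta>" by blast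
  have "((\<lambda>r. \<Sum>j\<in>A. monomial_profile j r) \<longlongrightarrow> (\<Sum>j\<in>A. 0)) (at_left 1)"
    by (intro tendsto_sum monomial_profile_tendsto_0)
  hence "\<forall>\<^sub>F r in at_left 1. (\<Sum>j\<in>A. monomial_profile j r) < \<eta>"
    using \<eta> by (intro order_tendstoD(2)) auto
  then obtain R0 where R0: "R0 < 1" "\<And>r. R0 < r \<Longrightarrow> r < 1 \<Longrightarrow> (\<Sum>j\<in>A. monomial_profile j r) < \<eta>"
    unfolding eventually_at_left_field by blast
  define R where "R = max R0 (1 / 2)"
  have R: "0 < R" "R < 1" "\<And>r. R < r \<Longrightarrow> r < 1 \<Longrightarrow> (\<Sum>j\<in>A. monomial_profile j r) < \<eta>"
    using R0 by (auto simp: R_def)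
  obtain N where N: "\<And>j r. N \<le> j \<Longrightarrow> r \<in> {0..R} \<Longrightarrow> monomial_profile j r \<le> \<eta>"
    using monomial_profile_uniform_small[OF R(1,2) \<eta>] unfolding eventually_sequentially by blast
  obtain j where j: "j \<in> J" "j > N + Max (insert 0 A)"
    using J by (meson infinite_nat_iff_unbounded)
  have "j \<notin> A"
  proof
    assume "j \<in> A"
    hence "j \<le> Max (insert 0 A)" using A(2) by (intro Max_ge) auto
    thus False using j(2) by linarith
  qed
  have "(\<Sum>j\<in>insert j A. monomial_profile j r) \<le> 1 + real (Suc k) * \<eta>" if r: "r \<in> {0..<1}" for r
  proof (cases "r \<le> R")
    case True
    thus ?thesis using N[of j r] bound[OF r] r j \<open>j \<notin> A\<close> A by (simp add: algebra_simps)
  next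
    case False
    hence "(\<Sum>j\<in>A. monomial_profile j r) < \<eta>" using R(3)[of r] r by simp
    moreover have "monomial_profile j r \<le> 1" using monomial_profile_le_1[of j r] r j by simp
    moreover have "0 \<le> real k * \<eta>" using \<eta> by simp
    ultimately show ?thesis using \<open>j \<notin> A\<close> A by (simp add: algebra_simps)
  qed
  thus ?case using A j \<open>j \<notin> A\<close> by (intro exI[of _ "insert j A"]) auto
qed

section \<open>Compact operators and normalised monomials\<close>

definition unit_monomial :: "nat \<Rightarrow> complex \<Rightarrow> complex" where
  "unit_monomial j z = (if z \<in> unit_disk then z ^ j / complex_of_real (monomial_norm j) else 0)"

lemma monomial_norm_pos: "1 \<le> j \<Longrightarrow> 0 < monomial_norm j"
  using monomial_norm_ge[of j] by linarith

lemma deriv_unit_monomial: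
  assumes "z \<in> unit_disk"
  shows "deriv (unit_monomial j) z = of_nat j * z ^ (j - 1) / complex_of_real (monomial_norm j)"
proof (rule DERIV_imp_deriv)
  have "((\<lambda>z. z ^ j / complex_of_real (monomial_norm j)) has_field_derivative
      of_nat j * z ^ (j - 1) / complex_of_real (monomial_norm j)) (at z)"
    by (auto intro!: derivative_eq_intros DERIV_cdivide)
  thus "(unit_monomial j has_field_derivative
      of_nat j * z ^ (j - 1) / complex_of_real (monomial_norm j)) (at z)"
    by (rule has_field_derivative_transform_within_open[OF _ open_ball assms])
       (simp add: unit_monomial_def)
qed

lemma norm_deriv_unit_monomial:
  assumes "z \<in> unit_disk" "1 \<le> j"
  shows "v_log z * cmod (deriv (unit_monomial j) z) = monomial_profile j (cmod z)"
  using monomial_norm_pos[OF assms(2)] assms(1)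
  by (simp add: deriv_unit_monomial monomial_profile_eq norm_mult norm_divide norm_power)

lemma unit_monomial_holomorphic: "unit_monomial j holomorphic_on unit_disk"
proof -
  have "(\<lambda>z. z ^ j / complex_of_real (monomial_norm j)) holomorphic_on unit_disk"
    unfolding divide_inverse by (intro holomorphic_intros)
  thus ?thesis by (rule holomorphic_transform) (simp add: unit_monomial_def)
qed

lemma unit_monomial_in_space:
  assumes "1 \<le> j"
  shows "unit_monomial j \<in> bloch_space v_log"
proof (rule bloch_spaceI[where C = 1])
  fix z assume z: "z \<in> unit_disk"
  thus "v_log z * cmod (deriv (unit_monomial j) z) \<le> 1"
    using monomial_profile_le_1[OF assms, of "cmod z"] norm_deriv_unit_monomial[OF z assms] by simp
qed (auto simp: unit_monomial_holomorphic unit_monomial_def)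

lemma unit_monomial_0: "1 \<le> j \<Longrightarrow> unit_monomial j 0 = 0"
  by (simp add: unit_monomial_def)

lemma bloch_norm_unit_monomial:
  assumes "1 \<le> j"
  shows "bloch_norm v_log (unit_monomial j) \<le> 1"
proof -
  have "bloch_norm v_log (unit_monomial j) \<le> cmod (unit_monomial j 0) + 1"
  proof (rule bloch_norm_le)
    fix z assume z: "z \<in> unit_disk"
    thus "v_log z * cmod (deriv (unit_monomial j) z) \<le> 1"
      using monomial_profile_le_1[OF assms, of "cmod z"] norm_deriv_unit_monomial[OF z assms] by simp
  qed simp
  thus ?thesis by (simp add: unit_monomial_0[OF assms])
qed

text \<open>For a sparse family of degrees \<open>C = 2\<close> will do, and with \<open>c = 1 / card A\<close> this says that the average of the
  normalised monomials has norm at most \<open>2 / card A\<close>.\<close>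

lemma norm_average_unit_monomials:
  assumes A: "finite A" "0 \<notin> A"
    and bound: "\<And>r. r \<in> {0..<1} \<Longrightarrow> (\<Sum>j\<in>A. monomial_profile j r) \<le> C" and C: "0 \<le> C" and c: "0 \<le> c"
  shows "bloch_norm v_log (\<lambda>z. \<Sum>j\<in>A. complex_of_real c * unit_monomial j z) \<le> c * C"
proof -
  have pos: "1 \<le> j" if "j \<in> A" for j using A(2) that by (cases j) auto
  have "bloch_norm v_log (\<lambda>z. \<Sum>j\<in>A. complex_of_real c * unit_monomial j z)
      \<le> cmod (\<Sum>j\<in>A. complex_of_real c * unit_monomial j 0) + c * C"
  proof (rule bloch_norm_le)
    fix z assume z: "z \<in> unit_disk"
    have "deriv (\<lambda>z. \<Sum>j\<in>A. complex_of_real c * unit_monomial j z) z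
        = (\<Sum>j\<in>A. complex_of_real c * deriv (unit_monomial j) z)"
      using z by (intro DERIV_imp_deriv DERIV_sum DERIV_cmult
          holomorphic_derivI[OF unit_monomial_holomorphic open_ball])
    hence "v_log z * cmod (deriv (\<lambda>z. \<Sum>j\<in>A. complex_of_real c * unit_monomial j z) z)
        \<le> v_log z * (\<Sum>j\<in>A. cmod (complex_of_real c * deriv (unit_monomial j) z))"
      using v_log_pos[of z] z by (simp add: norm_sum)
    also have "\<dots> = (\<Sum>j\<in>A. c * (v_log z * cmod (deriv (unit_monomial j) z)))"
      using c by (simp add: sum_distrib_left norm_mult mult_ac)
    also have "\<dots> = c * (\<Sum>j\<in>A. monomial_profile j (cmod z))"
      unfolding sum_distrib_left using pos z by (intro sum.cong) (auto simp: norm_deriv_unit_monomial)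
    also have "\<dots> \<le> c * C" using bound[of "cmod z"] z c by (intro mult_left_mono) auto
    finally show "v_log z * cmod (deriv (\<lambda>z. \<Sum>j\<in>A. complex_of_real c * unit_monomial j z) z) \<le> c * C" .
  qed (use C c in auto)
  moreover have "(\<Sum>j\<in>A. complex_of_real c * unit_monomial j 0) = 0"
    using pos by (intro sum.neutral) (auto simp: unit_monomial_0)
  ultimately show ?thesis by simp
qed

lemma linear_op_bound_scale:
  assumes T: "linear_op \<mu> \<nu> T" and B: "\<And>f. f \<in> bloch_unit_ball \<mu> \<Longrightarrow> bloch_norm \<nu> (T f) \<le> B"
    and f: "f \<in> bloch_space \<mu>" "bloch_norm \<mu> f \<le> \<beta>" "0 < \<beta>"
  shows "bloch_norm \<nu> (T f) \<le> \<beta> * B"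
proof -
  define g where "g = (\<lambda>z. complex_of_real (1 / \<beta>) * f z)"
  have g: "g \<in> bloch_space \<mu>" unfolding g_def by (rule bloch_space_scale_and_norm(1)[OF f(1)])
  have "bloch_norm \<mu> g \<le> 1 / \<beta> * bloch_norm \<mu> f"
    using bloch_space_scale_and_norm(2)[OF f(1), of "complex_of_real (1 / \<beta>)"] f(3)
    by (simp add: g_def norm_divide)
  also have "\<dots> \<le> 1" using f by (simp add: field_simps)
  finally have TgB: "bloch_norm \<nu> (T g) \<le> B" using g by (intro B) (simp add: bloch_unit_ball_def)
  have "T f = (\<lambda>z. complex_of_real \<beta> * T g z)"
    using linear_op_scale[OF T g, of "complex_of_real \<beta>"] f(3) by (simp add: g_def)
  hence "bloch_norm \<nu> (T f) \<le> \<beta> * bloch_norm \<nu> (T g)"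
    using bloch_space_scale_and_norm(2)[OF linear_op_closed[OF T g], of "complex_of_real \<beta>"] f(3) by simp
  also have "\<dots> \<le> \<beta> * B" using TgB f(3) by (intro mult_left_mono) auto
  finally show ?thesis .
qed

lemma compact_op_finite_net:
  assumes \<nu>: "weight \<nu>" and T: "compact_linear_op \<mu> \<nu> T" and \<epsilon>: "0 < \<epsilon>"
  shows "\<exists>N. finite N \<and> N \<subseteq> bloch_space \<nu> \<and>
           (\<forall>f\<in>bloch_unit_ball \<mu>. \<exists>g\<in>N. bloch_dist \<nu> g (T f) < \<epsilon>)"
proof -
  interpret Metric_space "bloch_space \<nu>" "bloch_dist \<nu>" by (rule Metric_space_bloch[OF \<nu>])
  define S where "S = mtopology closure_of (T ` bloch_unit_ball \<mu>)"
  have sub: "T ` bloch_unit_ball \<mu> \<subseteq> bloch_space \<nu>"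
    using T by (auto simp: compact_linear_op_def bloch_unit_ball_def linear_op_def)
  have "compactin mtopology S"
    using T by (simp add: compact_linear_op_def bloch_topology_def S_def)
  hence tb: "mtotally_bounded S" by (rule compactin_imp_mtotally_bounded)
  obtain N where N: "finite N" "N \<subseteq> S" "S \<subseteq> (\<Union>x\<in>N. mball x \<epsilon>)"
    using tb[unfolded mtotally_bounded_def, rule_format, OF \<epsilon>] by blast
  have TS: "T ` bloch_unit_ball \<mu> \<subseteq> S"
    unfolding S_def using sub by (intro closure_of_subset) simp
  have "S \<subseteq> bloch_space \<nu>"
    unfolding S_def using closure_of_subset_topspace[of mtopology] by simp
  hence "N \<subseteq> bloch_space \<nu>" using N(2) by (rule order_trans[rotated])
  moreover have "\<exists>g\<in>N. bloch_dist \<nu> g (T f) < \<epsilon>" if "f \<in> bloch_unit_ball \<mu>" for f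
  proof -
    have "T f \<in> (\<Union>x\<in>N. mball x \<epsilon>)" using that N(3) TS by blast
    thus ?thesis by (auto simp: in_mball)
  qed
  ultimately show ?thesis using N(1) by blast
qed

lemma compact_op_bounded:
  assumes \<nu>: "weight \<nu>" and T: "compact_linear_op \<mu> \<nu> T"
  shows "\<exists>B>0. \<forall>f\<in>bloch_unit_ball \<mu>. bloch_norm \<nu> (T f) \<le> B"
proof -
  obtain N where N: "finite N" "N \<subseteq> bloch_space \<nu>"
    "\<And>f. f \<in> bloch_unit_ball \<mu> \<Longrightarrow> \<exists>g\<in>N. bloch_dist \<nu> g (T f) < 1"
    using compact_op_finite_net[OF \<nu> T, of 1] by auto
  interpret Metric_space "bloch_space \<nu>" "bloch_dist \<nu>" by (rule Metric_space_bloch[OF \<nu>])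
  have bound: "bloch_norm \<nu> (T f) \<le> (\<Sum>g\<in>N. bloch_norm \<nu> g) + 1" if f: "f \<in> bloch_unit_ball \<mu>" for f
  proof -
    have Tf: "T f \<in> bloch_space \<nu>"
      using T f by (auto simp: compact_linear_op_def bloch_unit_ball_def linear_op_def)
    obtain g where g: "g \<in> N" "bloch_dist \<nu> g (T f) < 1" using N(3)[OF f] by blast
    have "bloch_norm \<nu> (T f) \<le> bloch_dist \<nu> (T f) g + bloch_norm \<nu> g"
      unfolding bloch_dist_def using g N(2) Tf by (intro bloch_norm_triangle_diff \<nu>) auto
    also have "bloch_dist \<nu> (T f) g = bloch_dist \<nu> g (T f)" by (rule commute)
    also have "bloch_norm \<nu> g \<le> (\<Sum>g\<in>N. bloch_norm \<nu> g)"
      using g(1) N(1) by (intro member_le_sum) auto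
    finally show ?thesis using g(2) by linarith
  qed
  have pos: "0 < (\<Sum>g\<in>N. bloch_norm \<nu> g) + 1" by (intro add_nonneg_pos sum_nonneg) auto
  show ?thesis using pos bound by (intro exI[of _ "(\<Sum>g\<in>N. bloch_norm \<nu> g) + 1"]) blast
qed

text \<open>This is weak nullity of the normalised monomials, obtained without duality. If infinitely many images stayed
  at norm at least \<open>\<delta>\<close>, total boundedness would put infinitely many of them within \<open>\<delta> / 4\<close> of one vector \<open>g\<close>. Balls are
  convex, so all averages of these images are that close to \<open>g\<close> too, and hence have norm at least \<open>\<delta> / 2\<close>. But averages
  over sparse families of monomials are small, and a compact operator is bounded.\<close>

lemma compact_op_unit_monomial_small:
  assumes \<nu>: "weight \<nu>" and T: "compact_linear_op v_log \<nu> T" and \<delta>: "0 < \<delta>"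
  shows "\<forall>\<^sub>F j in sequentially. bloch_norm \<nu> (T (unit_monomial j)) < \<delta>"
proof (rule ccontr)
  assume not_ev: "\<not> ?thesis"
  interpret Metric_space "bloch_space \<nu>" "bloch_dist \<nu>" by (rule Metric_space_bloch[OF \<nu>])
  have lin: "linear_op v_log \<nu> T" using T by (simp add: compact_linear_op_def)
  define J where "J = {j. 1 \<le> j \<and> \<delta> \<le> bloch_norm \<nu> (T (unit_monomial j))}"
  have "infinite J"
  proof
    assume "finite J"
    hence "\<forall>\<^sub>F j in sequentially. j \<notin> J"
      by (simp add: cofinite_eq_sequentially[symmetric] eventually_cofinite)
    hence "\<forall>\<^sub>F j in sequentially. bloch_norm \<nu> (T (unit_monomial j)) < \<delta>"
      using eventually_ge_at_top[of 1] by eventually_elim (auto simp: J_def)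
    thus False using not_ev by blast
  qed
  obtain N where N: "finite N" "N \<subseteq> bloch_space \<nu>"
    "\<And>f. f \<in> bloch_unit_ball v_log \<Longrightarrow> \<exists>g\<in>N. bloch_dist \<nu> g (T f) < \<delta> / 4"
    using compact_op_finite_net[OF \<nu> T, of "\<delta> / 4"] \<delta> by auto
  have ball: "unit_monomial j \<in> bloch_unit_ball v_log" if "j \<in> J" for j
    using that by (auto simp: J_def bloch_unit_ball_def unit_monomial_in_space bloch_norm_unit_monomial)
  have "J \<subseteq> (\<Union>g\<in>N. {j \<in> J. bloch_dist \<nu> g (T (unit_monomial j)) < \<delta> / 4})"
    using N(3)[OF ball] by auto
  hence "\<not> (\<forall>g\<in>N. finite {j \<in> J. bloch_dist \<nu> g (T (unit_monomial j)) < \<delta> / 4})"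
    using \<open>infinite J\<close> N(1) by (meson finite_UN finite_subset)
  then obtain g where g: "g \<in> N" and inf: "infinite {j \<in> J. bloch_dist \<nu> g (T (unit_monomial j)) < \<delta> / 4}"
    by blast
  define J' where "J' = {j \<in> J. bloch_dist \<nu> g (T (unit_monomial j)) < \<delta> / 4}"
  have g_space: "g \<in> bloch_space \<nu>" using g N(2) by auto
  have T_space: "T (unit_monomial j) \<in> bloch_space \<nu>" if "j \<in> J" for j
    using that by (intro linear_op_closed[OF lin] unit_monomial_in_space) (simp add: J_def)

  obtain B where B: "0 < B" "\<And>f. f \<in> bloch_unit_ball v_log \<Longrightarrow> bloch_norm \<nu> (T f) \<le> B"
    using compact_op_bounded[OF \<nu> T] by blast
  \<comment> \<open>The averages of \<open>k\<close> monomials will have norm at most \<open>2 / k\<close>, and \<open>2 * B / k < \<delta> / 2\<close>.\<close>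
  obtain k :: nat where k: "4 * B / \<delta> < real k" using reals_Archimedean2 by blast
  have "0 < 4 * B / \<delta>" using B \<delta> by simp
  hence k_pos: "0 < real k" using k by linarith
  have "infinite J'" using inf by (simp add: J'_def)
  then obtain A where A: "A \<subseteq> J'" "finite A" "card A = k"
    and profile: "\<And>r. r \<in> {0..<1} \<Longrightarrow> (\<Sum>j\<in>A. monomial_profile j r) \<le> 1 + real k * (1 / real k)"
    using sparse_monomials[of J' "1 / real k" k] k_pos by auto
  have AJ: "A \<subseteq> J" using A(1) by (auto simp: J'_def)
  have A1: "1 \<le> j" if "j \<in> A" for j using that AJ by (auto simp: J_def)
  define c where "c = complex_of_real (1 / real k)"
  define h where "h = (\<lambda>z. \<Sum>j\<in>A. c * unit_monomial j z)"
  have space: "(\<lambda>z. c * unit_monomial j z) \<in> bloch_space v_log" if "j \<in> A" for j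
    by (rule bloch_space_scale_and_norm(1)[OF unit_monomial_in_space[OF A1[OF that]]])
  have h_space: "h \<in> bloch_space v_log"
    unfolding h_def by (rule bloch_space_sum[OF weight_v_log space])
  have "0 \<notin> A" using A1 by force
  hence "bloch_norm v_log h \<le> 1 / real k * 2"
    unfolding h_def c_def using A(2) profile k_pos
    by (intro norm_average_unit_monomials) auto
  hence Th_small: "bloch_norm \<nu> (T h) \<le> 1 / real k * 2 * B"
    using k_pos by (intro linear_op_bound_scale[OF lin B(2) h_space]) simp_all
  have Th_eq: "T h = (\<lambda>z. \<Sum>j\<in>A. c * T (unit_monomial j) z)"
  proof -
    have "T h = (\<lambda>z. \<Sum>j\<in>A. T (\<lambda>z. c * unit_monomial j z) z)"
      unfolding h_def by (rule linear_op_sum[OF weight_v_log lin space])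
    also have "\<dots> = (\<lambda>z. \<Sum>j\<in>A. c * T (unit_monomial j) z)"
      using A1 by (intro ext sum.cong refl) (simp add: linear_op_scale[OF lin unit_monomial_in_space])
    finally show ?thesis .
  qed
  have kc: "of_nat k * c = 1" using k_pos by (simp add: c_def)
  have g_near: "bloch_norm \<nu> (\<lambda>z. g z - T h z) \<le> \<delta> / 4"
  proof -
    have eq: "(\<lambda>z. g z - T h z) = (\<lambda>z. \<Sum>j\<in>A. c * (g z - T (unit_monomial j) z))"
    proof
      fix z
      have "(\<Sum>j\<in>A. c * (g z - T (unit_monomial j) z)) = (of_nat k * c) * g z - T h z"
        by (simp add: Th_eq right_diff_distrib sum_subtractf A(3))
      thus "g z - T h z = (\<Sum>j\<in>A. c * (g z - T (unit_monomial j) z))" by (simp add: kc)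
    qed
    have d_space: "(\<lambda>z. g z - T (unit_monomial j) z) \<in> bloch_space \<nu>" if "j \<in> A" for j
      using that AJ by (intro bloch_space_diff[OF \<nu>] g_space T_space) auto
    have "bloch_norm \<nu> (\<lambda>z. g z - T h z) \<le> (\<Sum>j\<in>A. bloch_norm \<nu> (\<lambda>z. c * (g z - T (unit_monomial j) z)))"
      unfolding eq by (rule bloch_norm_sum_le[OF \<nu>]) (rule bloch_space_scale_and_norm(1)[OF d_space])
    also have "\<dots> \<le> (\<Sum>j\<in>A. 1 / real k * (\<delta> / 4))"
    proof (rule sum_mono)
      fix j assume j: "j \<in> A"
      have "bloch_norm \<nu> (\<lambda>z. c * (g z - T (unit_monomial j) z))
          \<le> cmod c * bloch_norm \<nu> (\<lambda>z. g z - T (unit_monomial j) z)"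
        by (rule bloch_space_scale_and_norm(2)[OF d_space[OF j]])
      also have "\<dots> \<le> 1 / real k * (\<delta> / 4)"
        using j A(1) k_pos
        by (intro mult_mono) (auto simp: c_def norm_divide J'_def bloch_dist_def intro: less_imp_le)
      finally show "bloch_norm \<nu> (\<lambda>z. c * (g z - T (unit_monomial j) z)) \<le> 1 / real k * (\<delta> / 4)" .
    qed
    also have "\<dots> = \<delta> / 4" using k_pos A(3) by simp
    finally show ?thesis .
  qed
  have "A \<noteq> {}" using A(3) k_pos by auto
  then obtain j where j: "j \<in> A" by blast
  have jJ: "j \<in> J" using j AJ by auto
  have "\<delta> \<le> bloch_norm \<nu> (T (unit_monomial j))" using jJ by (simp add: J_def)
  also have "\<dots> \<le> bloch_dist \<nu> (T (unit_monomial j)) g + bloch_norm \<nu> g"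
    unfolding bloch_dist_def by (rule bloch_norm_triangle_diff[OF \<nu> T_space[OF jJ] g_space])
  also have "bloch_dist \<nu> (T (unit_monomial j)) g < \<delta> / 4"
    using j A(1) by (auto simp: J'_def commute)
  also have "bloch_norm \<nu> g \<le> bloch_norm \<nu> (\<lambda>z. g z - T h z) + bloch_norm \<nu> (T h)"
    by (rule bloch_norm_triangle_diff[OF \<nu> g_space linear_op_closed[OF lin h_space]])
  finally have "\<delta> / 2 < bloch_norm \<nu> (T h)" using g_near by linarith
  moreover have "1 / real k * 2 * B < \<delta> / 2" using k k_pos \<delta> by (simp add: field_simps)
  ultimately show False using Th_small by linarith
qed

section \<open>Uniform polynomial approximation in the logarithmic growth space\<close>

text \<open>The derivatives of functions of Bloch norm at most 1 lie in this set; approximation is carried out at the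
  level of derivatives.\<close>

definition growth_ball :: "(complex \<Rightarrow> complex) set" where
  "growth_ball = {h. h holomorphic_on unit_disk \<and> (\<forall>z\<in>unit_disk. v_log z * cmod (h z) \<le> 1)}"

definition taylor_coeff :: "(complex \<Rightarrow> complex) \<Rightarrow> nat \<Rightarrow> complex" where
  "taylor_coeff f n = (deriv ^^ n) f 0 / fact n"

lemma taylor_sums:
  assumes "f holomorphic_on unit_disk" "z \<in> unit_disk"
  shows "(\<lambda>n. taylor_coeff f n * z ^ n) sums f z"
  using holomorphic_power_series[OF assms(1), of z] assms(2) by (simp add: taylor_coeff_def)

lemma taylor_coeff_deriv: "taylor_coeff (deriv f) n = of_nat (Suc n) * taylor_coeff f (Suc n)"
  by (simp add: taylor_coeff_def funpow_Suc_right fact_Suc del: funpow.simps of_nat_Suc)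

text \<open>Cauchy's inequality on a circle of radius \<open>\<rho>\<close>. The bound does not depend on the function, which makes all the
  power series estimates below uniform over the unit ball.\<close>

lemma taylor_coeff_le:
  assumes H: "h \<in> growth_ball" and \<rho>: "0 < \<rho>" "\<rho> < 1"
  shows "cmod (taylor_coeff h n) \<le> 1 / (v_log (of_real \<rho>) * \<rho> ^ n)"
proof -
  have h: "h holomorphic_on unit_disk" and le: "\<And>z. z \<in> unit_disk \<Longrightarrow> v_log z * cmod (h z) \<le> 1"
    using H by (auto simp: growth_ball_def)
  have sub: "cball 0 \<rho> \<subseteq> unit_disk" using \<rho> by auto
  have v: "0 < v_log (of_real \<rho>)" using \<rho> by (intro v_log_pos) auto
  have bd: "cmod (h w) \<le> 1 / v_log (of_real \<rho>)" if "norm (0 - w) = \<rho>" for w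
  proof -
    have "v_log w = v_log (of_real \<rho>)" using that \<rho> by (simp add: v_log_def)
    thus ?thesis using le[of w] that \<rho> v by (simp add: field_simps)
  qed
  have "cmod ((deriv ^^ n) h 0) \<le> fact n * (1 / v_log (of_real \<rho>)) / \<rho> ^ n"
    using \<rho> bd by (intro Cauchy_inequality holomorphic_on_subset[OF h]
        continuous_on_subset[OF holomorphic_on_imp_continuous_on[OF h] sub]) auto
  hence "cmod (taylor_coeff h n) \<le> fact n * (1 / v_log (of_real \<rho>)) / \<rho> ^ n / fact n"
    unfolding taylor_coeff_def norm_divide norm_fact by (intro divide_right_mono) auto
  thus ?thesis by simp
qed

text \<open>Termwise, the difference multiplies the \<open>n\<close>-th coefficient by \<open>1 - r ^ (n + 1) \<le> (n + 1) * (1 - r)\<close>. Cauchy's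
  inequality at a radius between \<open>R\<close> and 1 leaves a convergent series, so the whole is of order \<open>1 - r\<close>.
  The expression \<open>r * h (r * z)\<close> is the derivative of the dilation of a primitive of \<open>h\<close>.\<close>

lemma dilation_uniformly_close:
  assumes R: "0 < R" "R < 1" and \<epsilon>: "0 < \<epsilon>"
  shows "\<exists>r. 0 < r \<and> r < 1 \<and> (\<forall>h\<in>growth_ball. \<forall>z. cmod z \<le> R \<longrightarrow>
           cmod (h z - of_real r * h (of_real r * z)) \<le> \<epsilon>)"
proof -
  define \<rho> where "\<rho> = (1 + R) / 2"
  have \<rho>: "0 < \<rho>" "\<rho> < 1" "R < \<rho>" using R by (auto simp: \<rho>_def)
  define B where "B = 1 / v_log (of_real \<rho>)"
  have B: "0 < B" using v_log_pos[of "of_real \<rho>"] \<rho> by (simp add: B_def)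
  define q where "q = R / \<rho>"
  have q: "0 \<le> q" "q < 1" using R \<rho> by (auto simp: q_def)
  define S where "S = 1 / (1 - q)\<^sup>2"
  have S: "(\<lambda>n. real (Suc n) * q ^ n) sums S"
    unfolding S_def using q by (intro geometric_deriv_sums) auto
  have S_pos: "0 < S" using q by (simp add: S_def)
  define r where "r = max (1 / 2) (1 - \<epsilon> / (B * S))"
  have r: "0 < r" "r < 1" using \<epsilon> B S_pos by (auto simp: r_def)
  have r_eps: "(1 - r) * (B * S) \<le> \<epsilon>"
  proof -
    have "1 - r \<le> \<epsilon> / (B * S)" by (simp add: r_def)
    thus ?thesis using B S_pos by (simp add: pos_le_divide_eq)
  qed
  have "cmod (h z - of_real r * h (of_real r * z)) \<le> \<epsilon>" if H: "h \<in> growth_ball" and z: "cmod z \<le> R" for h z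
  proof -
    have h: "h holomorphic_on unit_disk" using H by (simp add: growth_ball_def)
    have zd: "z \<in> unit_disk" using z R by simp
    have "cmod (of_real r * z) \<le> cmod z" using r by (simp add: norm_mult mult_left_le_one_le)
    hence rzd: "of_real r * z \<in> unit_disk" using zd by simp
    let ?t = "\<lambda>n. taylor_coeff h n * z ^ n - of_real r * (taylor_coeff h n * (of_real r * z) ^ n)"
    have sums: "?t sums (h z - of_real r * h (of_real r * z))"
      by (intro sums_diff sums_mult taylor_sums h zd rzd)
    have term_le: "cmod (?t n) \<le> (1 - r) * B * (real (Suc n) * q ^ n)" for n
    proof -
      have "?t n = taylor_coeff h n * z ^ n * of_real (1 - r ^ Suc n)"
        by (simp add: algebra_simps power_mult_distrib)
      hence "cmod (?t n) = cmod (taylor_coeff h n) * cmod z ^ n * \<bar>1 - r ^ Suc n\<bar>"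
        by (simp only: norm_mult norm_power norm_of_real)
      also have "\<dots> = cmod (taylor_coeff h n) * cmod z ^ n * (1 - r ^ Suc n)"
        using r power_le_one[of r "Suc n"] by simp
      also have "\<dots> \<le> (1 / (v_log (of_real \<rho>) * \<rho> ^ n)) * R ^ n * (real (Suc n) * (1 - r))"
      proof (intro mult_mono taylor_coeff_le[OF H \<rho>(1,2)] power_mono z)
        have "1 + real (Suc n) * (r - 1) \<le> (1 + (r - 1)) ^ Suc n"
          using r by (intro Bernoulli_inequality) auto
        thus "1 - r ^ Suc n \<le> real (Suc n) * (1 - r)" by (simp add: algebra_simps)
        show "0 \<le> 1 - r ^ Suc n" using r power_le_one[of r "Suc n"] by simp
        show "0 \<le> 1 / (v_log (of_real \<rho>) * \<rho> ^ n)" "0 \<le> 1 / (v_log (of_real \<rho>) * \<rho> ^ n) * R ^ n"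
          using v_log_pos[of "of_real \<rho>"] \<rho> R by auto
      qed auto
      also have "\<dots> = (1 - r) * B * (real (Suc n) * q ^ n)"
        by (simp add: B_def q_def power_divide del: of_nat_Suc)
      finally show ?thesis .
    qed
    have bsums: "(\<lambda>n. (1 - r) * B * (real (Suc n) * q ^ n)) sums ((1 - r) * B * S)"
      by (rule sums_mult[OF S])
    have "cmod (suminf ?t) \<le> (\<Sum>n. (1 - r) * B * (real (Suc n) * q ^ n))"
      by (rule norm_suminf_le[OF term_le sums_summable[OF bsums]])
    hence "cmod (h z - of_real r * h (of_real r * z)) \<le> (1 - r) * B * S"
      using sums bsums by (simp add: sums_iff)
    thus "cmod (h z - of_real r * h (of_real r * z)) \<le> \<epsilon>" using r_eps by (simp add: mult_ac)
  qed
  thus ?thesis using r by blast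
qed

text \<open>Once \<open>r\<close> is fixed, the power series of a dilation converges geometrically on the whole disk, uniformly
  over the family: apply Cauchy's inequality at a radius between \<open>r\<close> and 1.\<close>

lemma dilation_truncation_uniformly_close:
  assumes r: "0 < r" "r < 1" and \<epsilon>: "0 < \<epsilon>"
  shows "\<exists>N. \<forall>h\<in>growth_ball. \<forall>z\<in>unit_disk.
           cmod (of_real r * h (of_real r * z) - (\<Sum>n<N. taylor_coeff h n * of_real r ^ Suc n * z ^ n)) \<le> \<epsilon>"
proof -
  define \<rho> where "\<rho> = (1 + r) / 2"
  have \<rho>: "0 < \<rho>" "\<rho> < 1" "r < \<rho>" using r by (auto simp: \<rho>_def)
  define B where "B = 1 / v_log (of_real \<rho>)"
  have B: "0 < B" using v_log_pos[of "of_real \<rho>"] \<rho> by (simp add: B_def)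
  define q where "q = r / \<rho>"
  have q: "0 \<le> q" "q < 1" using r \<rho> by (auto simp: q_def)
  have "(\<lambda>N. B / (1 - q) * q ^ N) \<longlonglongrightarrow> B / (1 - q) * 0"
    using q by (intro tendsto_mult tendsto_const LIMSEQ_realpow_zero) auto
  hence "\<forall>\<^sub>F N in sequentially. B / (1 - q) * q ^ N < \<epsilon>"
    using \<epsilon> by (intro order_tendstoD(2)) auto
  then obtain N where N: "B / (1 - q) * q ^ N < \<epsilon>"
    using eventually_happens'[OF sequentially_bot] by blast
  show ?thesis
  proof (intro exI[of _ N] ballI)
    fix h z assume H: "h \<in> growth_ball" and "z \<in> unit_disk"
    hence h: "h holomorphic_on unit_disk" and z: "cmod z < 1" by (simp_all add: growth_ball_def)
    have "cmod (of_real r * z) \<le> cmod z" using r by (simp add: norm_mult mult_left_le_one_le)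
    hence rzd: "of_real r * z \<in> unit_disk" using z by simp
    let ?t = "\<lambda>n. taylor_coeff h n * of_real r ^ Suc n * z ^ n"
    have "(\<lambda>n. of_real r * (taylor_coeff h n * (of_real r * z) ^ n)) sums (of_real r * h (of_real r * z))"
      by (intro sums_mult taylor_sums h rzd)
    hence "?t sums (of_real r * h (of_real r * z))"
      by (simp add: power_mult_distrib mult_ac)
    hence sums: "(\<lambda>n. ?t (n + N)) sums (of_real r * h (of_real r * z) - (\<Sum>n<N. ?t n))"
      by (rule sums_split_initial_segment)
    have term_le: "cmod (?t (n + N)) \<le> B * q ^ N * q ^ n" for n
    proof -
      have "cmod (?t (n + N)) = cmod (taylor_coeff h (n + N)) * r ^ Suc (n + N) * cmod z ^ (n + N)"
        using r by (simp only: norm_mult norm_power norm_of_real abs_of_pos)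
      also have "\<dots> \<le> (1 / (v_log (of_real \<rho>) * \<rho> ^ (n + N))) * r ^ (n + N) * 1"
      proof (intro mult_mono taylor_coeff_le[OF H \<rho>(1,2)])
        show "r ^ Suc (n + N) \<le> r ^ (n + N)" using r by (intro power_decreasing) auto
        show "cmod z ^ (n + N) \<le> 1" using z by (intro power_le_one) auto
        show "0 \<le> 1 / (v_log (of_real \<rho>) * \<rho> ^ (n + N))" "0 \<le> 1 / (v_log (of_real \<rho>) * \<rho> ^ (n + N)) * r ^ (n + N)"
          using v_log_pos[of "of_real \<rho>"] \<rho> r by auto
      qed (use r in auto)
      also have "\<dots> = B * q ^ N * q ^ n"
        by (simp add: B_def q_def power_divide power_add mult_ac)
      finally show ?thesis .
    qed
    have bsums: "(\<lambda>n. B * q ^ N * q ^ n) sums (B * q ^ N * (1 / (1 - q)))"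
      using q by (intro sums_mult geometric_sums) auto
    have "cmod (\<Sum>n. ?t (n + N)) \<le> (\<Sum>n. B * q ^ N * q ^ n)"
      by (rule norm_suminf_le[OF term_le sums_summable[OF bsums]])
    hence "cmod (of_real r * h (of_real r * z) - (\<Sum>n<N. ?t n)) \<le> B * q ^ N * (1 / (1 - q))"
      using sums bsums by (simp only: sums_iff)
    also have "\<dots> \<le> \<epsilon>" using N by simp
    finally show "cmod (of_real r * h (of_real r * z) - (\<Sum>n<N. ?t n)) \<le> \<epsilon>" .
  qed
qed

text \<open>Plain Taylor polynomials are not uniformly bounded in a growth norm, hence the dilation: it does not increase
  that norm, as the weight decreases towards the boundary, and the truncation error after it is uniformly small.
  Thus the error is small on \<open>|z| \<le> R\<close> and remains bounded in the growth norm near the boundary.\<close>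

lemma taylor_approximation:
  assumes R: "0 < R" "R < 1" and \<epsilon>: "0 < \<epsilon>"
  shows "\<exists>r N. 0 < r \<and> r < 1 \<and> (\<forall>h\<in>growth_ball. \<forall>z.
     (cmod z \<le> R \<longrightarrow> cmod (h z - (\<Sum>n<N. taylor_coeff h n * of_real r ^ Suc n * z ^ n)) \<le> \<epsilon>) \<and>
     (cmod z < 1 \<longrightarrow> v_log z * cmod (h z - (\<Sum>n<N. taylor_coeff h n * of_real r ^ Suc n * z ^ n)) \<le> 2 + 2 * \<epsilon>))"
proof -
  have \<epsilon>2: "0 < \<epsilon> / 2" using \<epsilon> by simp
  obtain r where r: "0 < r" "r < 1" and dil: "\<And>h z. h \<in> growth_ball \<Longrightarrow> cmod z \<le> R \<Longrightarrow>
       cmod (h z - of_real r * h (of_real r * z)) \<le> \<epsilon> / 2"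
    using dilation_uniformly_close[OF R \<epsilon>2] by blast
  obtain N where trunc: "\<And>h z. h \<in> growth_ball \<Longrightarrow> z \<in> unit_disk \<Longrightarrow>
       cmod (of_real r * h (of_real r * z) - (\<Sum>n<N. taylor_coeff h n * of_real r ^ Suc n * z ^ n)) \<le> \<epsilon> / 2"
    using dilation_truncation_uniformly_close[OF r \<epsilon>2] by blast
  show ?thesis
  proof (intro exI[of _ r] exI[of _ N] conjI r ballI allI impI)
    fix h z assume H: "h \<in> growth_ball"
    have le: "v_log w * cmod (h w) \<le> 1" if "w \<in> unit_disk" for w
      using H that by (simp add: growth_ball_def)
    let ?P = "\<Sum>n<N. taylor_coeff h n * of_real r ^ Suc n * z ^ n"
    let ?D = "of_real r * h (of_real r * z)"
    show "cmod (h z - ?P) \<le> \<epsilon>" if z: "cmod z \<le> R"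
    proof -
      have "cmod (h z - ?D) \<le> \<epsilon> / 2" by (rule dil[OF H z])
      moreover have "cmod (?D - ?P) \<le> \<epsilon> / 2" using z R by (intro trunc[OF H]) auto
      ultimately show ?thesis using norm_triangle_ineq[of "h z - ?D" "?D - ?P"] by simp
    qed
    show "v_log z * cmod (h z - ?P) \<le> 2 + 2 * \<epsilon>" if z: "cmod z < 1"
    proof -
      have rz: "cmod (of_real r * z) \<le> cmod z" using r by (simp add: norm_mult mult_left_le_one_le)
      have v: "0 < v_log z" "v_log z \<le> 2" using v_log_pos[OF z] v_log_le_2[OF z] by auto
      have 1: "v_log z * cmod (h z) \<le> 1" using le[of z] z by simp
      have "v_log z * (r * cmod (h (of_real r * z))) \<le> v_log z * (1 * cmod (h (of_real r * z)))"
        using v r by (intro mult_left_mono mult_right_mono) auto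
      also have "\<dots> \<le> v_log (of_real r * z) * cmod (h (of_real r * z))"
        using v_log_antimono[OF rz z] by (simp add: mult_right_mono)
      also have "\<dots> \<le> 1" using rz z by (intro le) simp
      finally have 2: "v_log z * cmod ?D \<le> 1" using r by (simp add: norm_mult)
      have "v_log z * cmod (?D - ?P) \<le> 2 * (\<epsilon> / 2)"
        using v \<epsilon> by (intro mult_mono trunc[OF H]) (auto simp: z)
      moreover have "cmod (h z - ?P) \<le> cmod (h z) + cmod ?D + cmod (?D - ?P)"
        using norm_triangle_ineq[of "h z - ?D" "?D - ?P"] norm_triangle_ineq4[of "h z" ?D] by simp
      hence "v_log z * cmod (h z - ?P) \<le> v_log z * (cmod (h z) + cmod ?D + cmod (?D - ?P))"
        using v by (intro mult_left_mono) auto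
      ultimately show ?thesis using 1 2 \<epsilon> by (simp add: distrib_left)
    qed
  qed
qed

section \<open>Finite-rank operators between Bloch spaces\<close>

text \<open>The inductive step for the compactness of a finite-dimensional polydisc, by extracting a subsequence first
  for the vector and then for the coefficient.\<close>

lemma compactin_add_multiples:
  assumes \<nu>: "weight \<nu>" and S: "compactin (bloch_topology \<nu>) S" and e: "e \<in> bloch_space \<nu>"
  shows "compactin (bloch_topology \<nu>) {(\<lambda>z. g z + a * e z) |g a. g \<in> S \<and> a \<in> cball 0 M}"
    (is "compactin _ ?S")
proof -
  interpret Metric_space "bloch_space \<nu>" "bloch_dist \<nu>" by (rule Metric_space_bloch[OF \<nu>])
  have S: "compactin mtopology S" using S by (simp add: bloch_topology_def)
  have "compactin mtopology ?S"
    unfolding compactin_sequentially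
  proof (intro conjI allI impI)
    have mem: "(\<lambda>z. g z + a * e z) \<in> bloch_space \<nu>" if "g \<in> bloch_space \<nu>" for g a
      by (rule bloch_space_add_and_norm(1)[OF \<nu> that bloch_space_scale_and_norm(1)[OF e]])
    have S_space: "S \<subseteq> bloch_space \<nu>" using S compactin_subset_topspace by force
    show "?S \<subseteq> bloch_space \<nu>" using mem S_space by blast
    fix \<sigma> :: "nat \<Rightarrow> complex \<Rightarrow> complex" assume "range \<sigma> \<subseteq> ?S"
    hence "\<forall>k. \<exists>g a. \<sigma> k = (\<lambda>z. g z + a * e z) \<and> g \<in> S \<and> a \<in> cball 0 M"
      by blast
    then obtain g a where \<sigma>: "\<And>k. \<sigma> k = (\<lambda>z. g k z + a k * e z)"
      and g: "\<And>k. g k \<in> S" and a: "\<And>k. a k \<in> cball 0 M" by metis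
    have "range g \<subseteq> S" using g by blast
    then obtain l r where l: "l \<in> S" "strict_mono r" "limitin mtopology (g \<circ> r) l sequentially"
      using S unfolding compactin_sequentially by meson
    have "seq_compact (cball 0 M :: complex set)"
      by (simp add: compact_eq_seq_compact_metric[symmetric])
    then obtain b s where b: "b \<in> cball 0 M" "strict_mono s" "((a \<circ> r) \<circ> s) \<longlonglongrightarrow> b"
      using a unfolding seq_compact_def by (metis comp_apply)
    have gl: "limitin mtopology ((g \<circ> r) \<circ> s) l sequentially"
      by (rule limitin_subsequence[OF b(2) l(3)])
    define L where "L = (\<lambda>z. l z + b * e z)"
    have l_space: "l \<in> bloch_space \<nu>" using l(1) S_space by blast
    have "limitin mtopology (\<sigma> \<circ> (r \<circ> s)) L sequentially"
      unfolding limitin_metric_dist_null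
    proof (intro conjI)
      show "L \<in> bloch_space \<nu>" unfolding L_def by (rule mem[OF l_space])
      show "\<forall>\<^sub>F k in sequentially. (\<sigma> \<circ> (r \<circ> s)) k \<in> bloch_space \<nu>"
        using g S_space by (intro always_eventually allI) (auto simp: \<sigma> intro!: mem)
      have bound: "bloch_dist \<nu> ((\<sigma> \<circ> (r \<circ> s)) k) L
          \<le> bloch_dist \<nu> (((g \<circ> r) \<circ> s) k) l + cmod (((a \<circ> r) \<circ> s) k - b) * bloch_norm \<nu> e" for k
      proof -
        let ?k = "r (s k)"
        have gk: "(\<lambda>z. g ?k z - l z) \<in> bloch_space \<nu>"
          using g S_space by (intro bloch_space_diff[OF \<nu> _ l_space]) auto
        have "bloch_norm \<nu> (\<lambda>z. (g ?k z - l z) + (a ?k - b) * e z)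
            \<le> bloch_norm \<nu> (\<lambda>z. g ?k z - l z) + bloch_norm \<nu> (\<lambda>z. (a ?k - b) * e z)"
          by (rule bloch_space_add_and_norm(2)[OF \<nu> gk bloch_space_scale_and_norm(1)[OF e]])
        also have "bloch_norm \<nu> (\<lambda>z. (a ?k - b) * e z) \<le> cmod (a ?k - b) * bloch_norm \<nu> e"
          by (rule bloch_space_scale_and_norm(2)[OF e])
        finally show ?thesis by (simp add: bloch_dist_def \<sigma> L_def algebra_simps)
      qed
      have "(\<lambda>k. bloch_dist \<nu> (((g \<circ> r) \<circ> s) k) l + cmod (((a \<circ> r) \<circ> s) k - b) * bloch_norm \<nu> e)
          \<longlonglongrightarrow> 0 + 0 * bloch_norm \<nu> e"
      proof (intro tendsto_add tendsto_mult tendsto_const)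
        show "(\<lambda>k. bloch_dist \<nu> (((g \<circ> r) \<circ> s) k) l) \<longlonglongrightarrow> 0"
          using gl unfolding limitin_metric_dist_null by blast
        show "(\<lambda>k. cmod (((a \<circ> r) \<circ> s) k - b)) \<longlonglongrightarrow> 0"
          by (rule tendsto_norm_zero[OF LIM_zero[OF b(3)]])
      qed
      hence lim: "(\<lambda>k. bloch_dist \<nu> (((g \<circ> r) \<circ> s) k) l + cmod (((a \<circ> r) \<circ> s) k - b) * bloch_norm \<nu> e)
          \<longlonglongrightarrow> 0" by simp
      show "(\<lambda>k. bloch_dist \<nu> ((\<sigma> \<circ> (r \<circ> s)) k) L) \<longlonglongrightarrow> 0"
      proof (rule Lim_null_comparison[OF always_eventually lim], rule allI)
        show "norm (bloch_dist \<nu> ((\<sigma> \<circ> (r \<circ> s)) k) L)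
            \<le> bloch_dist \<nu> (((g \<circ> r) \<circ> s) k) l + cmod (((a \<circ> r) \<circ> s) k - b) * bloch_norm \<nu> e" for k
          unfolding real_norm_def abs_of_nonneg[OF nonneg] by (rule bound)
      qed
    qed
    moreover have "L \<in> ?S" unfolding L_def
      by (rule CollectI) (intro exI[of _ l] exI[of _ b] conjI refl l(1) b(1))
    moreover have "strict_mono (r \<circ> s)" using l(2) b(2) by (rule strict_mono_o)
    ultimately show "\<exists>l r. l \<in> ?S \<and> strict_mono r \<and> limitin mtopology (\<sigma> \<circ> r) l sequentially"
      by (intro exI[of _ L] exI[of _ "r \<circ> s"] conjI)
  qed
  thus ?thesis by (simp add: bloch_topology_def)
qed

lemma compactin_bounded_combinations:
  fixes N :: nat
  assumes \<nu>: "weight \<nu>" and e: "\<And>n. n < N \<Longrightarrow> e n \<in> bloch_space \<nu>"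
  shows "compactin (bloch_topology \<nu>) {(\<lambda>z. \<Sum>n<N. c n * e n z) |c. \<forall>n<N. cmod (c n) \<le> M n}"
    (is "compactin _ (?S N)")
  using e
proof (induction N)
  case 0
  have "?S 0 = {\<lambda>z. 0}" by auto
  thus ?case
    using bloch_space_zero[of \<nu>] Metric_space.topspace_mtopology[OF Metric_space_bloch[OF \<nu>]]
    by (simp add: bloch_topology_def finite_imp_compactin)
next
  case (Suc N)
  have split: "?S (Suc N) = {(\<lambda>z. g z + a * e N z) |g a. g \<in> ?S N \<and> a \<in> cball 0 (M N)}"
  proof (intro equalityI subsetI)
    fix f assume "f \<in> ?S (Suc N)"
    then obtain c where c: "f = (\<lambda>z. \<Sum>n<Suc N. c n * e n z)" "\<forall>n<Suc N. cmod (c n) \<le> M n" by blast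
    hence m1: "(\<lambda>z. \<Sum>n<N. c n * e n z) \<in> ?S N" by auto
    have m2: "c N \<in> cball 0 (M N)" using c(2) by simp
    show "f \<in> {(\<lambda>z. g z + a * e N z) |g a. g \<in> ?S N \<and> a \<in> cball 0 (M N)}"
      unfolding c(1) sum.lessThan_Suc
      by (rule CollectI) (intro exI[of _ "\<lambda>z. \<Sum>n<N. c n * e n z"] exI[of _ "c N"] conjI refl m1 m2)
  next
    fix f assume "f \<in> {(\<lambda>z. g z + a * e N z) |g a. g \<in> ?S N \<and> a \<in> cball 0 (M N)}"
    then obtain c a where c: "f = (\<lambda>z. (\<Sum>n<N. c n * e n z) + a * e N z)"
      "\<forall>n<N. cmod (c n) \<le> M n" "cmod a \<le> M N" by auto
    have "f = (\<lambda>z. \<Sum>n<Suc N. (c(N := a)) n * e n z)" by (simp add: c(1))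
    moreover have "\<forall>n<Suc N. cmod ((c(N := a)) n) \<le> M n" using c by (simp add: less_Suc_eq)
    ultimately show "f \<in> ?S (Suc N)" by blast
  qed
  show ?case
    unfolding split using Suc by (intro compactin_add_multiples[OF \<nu>]) auto
qed

text \<open>The image of the unit ball lies in a polydisc spanned by the \<open>e n\<close>, which is compact and therefore closed, so
  it also contains the closure of the image.\<close>

lemma finite_rank_compact:
  fixes N :: nat
  assumes \<nu>: "weight \<nu>" and e: "\<And>n. n < N \<Longrightarrow> e n \<in> bloch_space \<nu>"
    and add: "\<And>n f g. n < N \<Longrightarrow> f \<in> bloch_space \<mu> \<Longrightarrow> g \<in> bloch_space \<mu> \<Longrightarrow>
                \<Lambda> n (\<lambda>z. f z + g z) = \<Lambda> n f + \<Lambda> n g"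
    and scale: "\<And>n c f. n < N \<Longrightarrow> f \<in> bloch_space \<mu> \<Longrightarrow> \<Lambda> n (\<lambda>z. c * f z) = c * \<Lambda> n f"
    and bound: "\<And>n f. n < N \<Longrightarrow> f \<in> bloch_unit_ball \<mu> \<Longrightarrow> cmod (\<Lambda> n f) \<le> M n"
  shows "compact_linear_op \<mu> \<nu> (\<lambda>f z. \<Sum>n<N. \<Lambda> n f * e n z)"
proof -
  interpret Metric_space "bloch_space \<nu>" "bloch_dist \<nu>" by (rule Metric_space_bloch[OF \<nu>])
  let ?T = "\<lambda>f z. \<Sum>n<N. \<Lambda> n f * e n z"
  have "linear_op \<mu> \<nu> ?T"
    unfolding linear_op_def
  proof (intro conjI ballI allI)
    show "?T f \<in> bloch_space \<nu>" for f
      by (rule bloch_space_sum[OF \<nu>]) (rule bloch_space_scale_and_norm(1)[OF e], simp)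
    show "?T (\<lambda>z. f z + g z) = (\<lambda>z. ?T f z + ?T g z)"
      if "f \<in> bloch_space \<mu>" "g \<in> bloch_space \<mu>" for f g
      using that by (simp add: add distrib_right sum.distrib)
    show "?T (\<lambda>z. c * f z) = (\<lambda>z. c * ?T f z)" if "f \<in> bloch_space \<mu>" for c f
      using that by (simp add: scale sum_distrib_left mult.assoc)
  qed
  moreover have "compactin mtopology (mtopology closure_of (?T ` bloch_unit_ball \<mu>))"
  proof -
    let ?S = "{(\<lambda>z. \<Sum>n<N. c n * e n z) |c. \<forall>n<N. cmod (c n) \<le> M n}"
    have S: "compactin mtopology ?S"
      using compactin_bounded_combinations[OF \<nu> e] by (simp add: bloch_topology_def)
    have "closedin mtopology ?S"
      by (rule compactin_imp_closedin[OF Hausdorff_space_mtopology S])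
    moreover have "?T ` bloch_unit_ball \<mu> \<subseteq> ?S"
    proof
      fix y assume "y \<in> ?T ` bloch_unit_ball \<mu>"
      then obtain f where f: "f \<in> bloch_unit_ball \<mu>" "y = ?T f" by blast
      have "\<forall>n<N. cmod (\<Lambda> n f) \<le> M n" using bound f(1) by blast
      thus "y \<in> ?S" unfolding f(2) by (intro CollectI exI[of _ "\<lambda>n. \<Lambda> n f"] conjI refl)
    qed
    ultimately have "mtopology closure_of (?T ` bloch_unit_ball \<mu>) \<subseteq> ?S"
      by (rule closure_of_minimal[rotated])
    thus ?thesis by (rule closed_compactin[OF S _ closedin_closure_of])
  qed
  ultimately show ?thesis by (simp add: compact_linear_op_def bloch_topology_def)
qed

section \<open>From powers of the symbol to the essential norm\<close>

lemma deriv_power_holomorphic: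
  assumes "\<phi> holomorphic_on unit_disk" "z \<in> unit_disk"
  shows "deriv (\<lambda>z. \<phi> z ^ j) z = of_nat j * \<phi> z ^ (j - 1) * deriv \<phi> z"
  by (rule DERIV_imp_deriv)
     (auto intro!: derivative_eq_intros holomorphic_derivI[OF assms(1) open_ball assms(2)])

lemma deriv_composition_op:
  assumes "f holomorphic_on unit_disk" "\<phi> holomorphic_on unit_disk" "\<phi> ` unit_disk \<subseteq> unit_disk"
    and z: "z \<in> unit_disk"
  shows "deriv (composition_op \<phi> f) z = deriv f (\<phi> z) * deriv \<phi> z"
proof (rule DERIV_imp_deriv)
  have \<phi>z: "\<phi> z \<in> unit_disk" using assms(3) z by blast
  have "((\<lambda>z. f (\<phi> z)) has_field_derivative deriv f (\<phi> z) * deriv \<phi> z) (at z)"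
    by (rule DERIV_chain2[OF holomorphic_derivI[OF assms(1) open_ball \<phi>z]
          holomorphic_derivI[OF assms(2) open_ball z]])
  thus "(composition_op \<phi> f has_field_derivative deriv f (\<phi> z) * deriv \<phi> z) (at z)"
    by (rule has_field_derivative_transform_within_open[OF _ open_ball z]) (simp add: composition_op_def)
qed

text \<open>The composition operator maps the monomial of degree \<open>j\<close> to the \<open>j\<close>-th power of the symbol, so the quotient is
  the seminorm of the image of a normalised monomial.\<close>

lemma power_ratio_le_norm_composition:
  assumes \<phi>: "\<phi> holomorphic_on unit_disk" "\<phi> ` unit_disk \<subseteq> unit_disk"
    and C: "composition_op \<phi> (unit_monomial j) \<in> bloch_space \<mu>" and j: "1 \<le> j"
  shows "bloch_seminorm \<mu> (\<lambda>z. \<phi> z ^ j) / bloch_seminorm v_log (\<lambda>z. z ^ j)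
           \<le> ennreal (bloch_norm \<mu> (composition_op \<phi> (unit_monomial j)))"
proof -
  define F where "F = monomial_norm j"
  define x where "x = bloch_norm \<mu> (composition_op \<phi> (unit_monomial j))"
  have F: "0 < F" using monomial_norm_pos[OF j] by (simp add: F_def)
  have "bloch_seminorm \<mu> (\<lambda>z. \<phi> z ^ j) \<le> ennreal (F * x)"
  proof (rule bloch_seminorm_le)
    fix z assume z: "z \<in> unit_disk"
    hence \<phi>z: "\<phi> z \<in> unit_disk" using \<phi>(2) by blast
    have "deriv (\<lambda>z. \<phi> z ^ j) z = of_real F * deriv (composition_op \<phi> (unit_monomial j)) z"
      using F by (simp add: deriv_power_holomorphic[OF \<phi>(1) z] F_def deriv_unit_monomial[OF \<phi>z]
          deriv_composition_op[OF unit_monomial_holomorphic \<phi> z])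
    hence "\<mu> z * cmod (deriv (\<lambda>z. \<phi> z ^ j) z) = F * (\<mu> z * cmod (deriv (composition_op \<phi> (unit_monomial j)) z))"
      using F by (simp add: norm_mult)
    also have "\<dots> \<le> F * x"
      unfolding x_def using F by (intro mult_left_mono deriv_le_bloch_norm[OF C z]) auto
    finally show "\<mu> z * cmod (deriv (\<lambda>z. \<phi> z ^ j) z) \<le> F * x" .
  qed
  hence "bloch_seminorm \<mu> (\<lambda>z. \<phi> z ^ j) / ennreal F \<le> ennreal (F * x) / ennreal F"
    by (rule divide_right_mono_ennreal)
  also have "\<dots> = ennreal x"
    using F by (simp add: divide_ennreal x_def)
  finally show ?thesis by (simp add: bloch_seminorm_monomial[OF j] F_def x_def)
qed

text \<open>For compact \<open>K\<close> the images of the normalised monomials under \<open>K\<close> tend to 0, so on them \<open>C - K\<close> is asymptotically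
  as large as the composition operator \<open>C\<close> itself.\<close>

lemma limsup_le_essential_norm:
  assumes \<mu>: "weight \<mu>" and \<phi>: "\<phi> holomorphic_on unit_disk" "\<phi> ` unit_disk \<subseteq> unit_disk"
    and C: "bounded_linear_op v_log \<mu> (composition_op \<phi>)"
  shows "limsup (\<lambda>j. bloch_seminorm \<mu> (\<lambda>z. \<phi> z ^ j) / bloch_seminorm v_log (\<lambda>z. z ^ j))
           \<le> essential_norm v_log \<mu> (composition_op \<phi>)"
  unfolding essential_norm_def
proof (rule INF_greatest)
  fix K assume "K \<in> {K. compact_linear_op v_log \<mu> K}"
  hence K: "compact_linear_op v_log \<mu> K" by simp
  hence Klin: "linear_op v_log \<mu> K" by (simp add: compact_linear_op_def)
  have Clin: "linear_op v_log \<mu> (composition_op \<phi>)" using C by (simp add: bounded_linear_op_def)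
  let ?D = "operator_norm v_log \<mu> (\<lambda>f z. composition_op \<phi> f z - K f z)"
  let ?r = "\<lambda>j. bloch_seminorm \<mu> (\<lambda>z. \<phi> z ^ j) / bloch_seminorm v_log (\<lambda>z. z ^ j)"
  show "limsup ?r \<le> ?D"
  proof (rule ennreal_le_epsilon)
    fix \<delta> :: real assume \<delta>: "0 < \<delta>"
    have "\<forall>\<^sub>F j in sequentially. ?r j \<le> ?D + ennreal \<delta>"
      using compact_op_unit_monomial_small[OF \<mu> K \<delta>] eventually_ge_at_top[of 1]
    proof eventually_elim
      case (elim j)
      have u: "unit_monomial j \<in> bloch_space v_log" by (rule unit_monomial_in_space[OF elim(2)])
      have Cu: "composition_op \<phi> (unit_monomial j) \<in> bloch_space \<mu>" by (rule linear_op_closed[OF Clin u])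
      have Ku: "K (unit_monomial j) \<in> bloch_space \<mu>" by (rule linear_op_closed[OF Klin u])
      have ball: "unit_monomial j \<in> bloch_unit_ball v_log"
        using u bloch_norm_unit_monomial[OF elim(2)] by (simp add: bloch_unit_ball_def)
      define d where "d = bloch_norm \<mu> (\<lambda>z. composition_op \<phi> (unit_monomial j) z - K (unit_monomial j) z)"
      have "bloch_norm \<mu> (composition_op \<phi> (unit_monomial j)) \<le> d + \<delta>"
        using bloch_norm_triangle_diff[OF \<mu> Cu Ku] elim(1) unfolding d_def by linarith
      hence "?r j \<le> ennreal (d + \<delta>)"
        by (intro order_trans[OF power_ratio_le_norm_composition[OF \<phi> Cu elim(2)]] ennreal_leI)
      also have "\<dots> = ennreal d + ennreal \<delta>" using \<delta> by (simp add: d_def)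
      also have "ennreal d \<le> ?D"
        unfolding operator_norm_def d_def by (rule SUP_upper[OF ball])
      finally show ?case by (simp add: add_right_mono)
    qed
    thus "limsup ?r \<le> ?D + ennreal \<delta>" by (rule Limsup_bounded)
  qed
qed

text \<open>In the application \<open>D z\<close> is \<open>\<mu> z * |\<phi>' z|\<close> and the hypothesis bounds the seminorms of high powers of \<open>\<phi>\<close>. At a
  point whose image has distance \<open>t\<close> from the circle, use the power of degree about \<open>1 / (2 * t)\<close>, the monomial of which
  attains its seminorm there up to a factor 4.\<close>

lemma hyperbolic_derivative_bound:
  assumes \<phi>: "\<phi> ` unit_disk \<subseteq> unit_disk" and c: "0 \<le> c"
    and le: "\<And>j z. J \<le> j \<Longrightarrow> 1 \<le> j \<Longrightarrow> z \<in> unit_disk \<Longrightarrow>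
               D z * (real j * cmod (\<phi> z) ^ (j - 1)) \<le> c * monomial_norm j"
  shows "\<exists>R0<1. \<forall>z\<in>unit_disk. R0 < cmod (\<phi> z) \<longrightarrow> D z \<le> 4 * c * v_log (\<phi> z)"
proof (intro exI[of _ "1 - 1 / (2 * (real J + 1))"] conjI ballI impI)
  show "1 - 1 / (2 * (real J + 1)) < 1" by simp
next
  fix z assume z: "z \<in> unit_disk" and big: "1 - 1 / (2 * (real J + 1)) < cmod (\<phi> z)"
  have "\<phi> z \<in> unit_disk" using \<phi> z by blast
  hence "cmod (\<phi> z) < 1" by simp
  define t where "t = 1 - cmod (\<phi> z)"
  have t: "0 < t" "t < 1 / (2 * (real J + 1))" and r: "cmod (\<phi> z) = 1 - t"
    using \<open>cmod (\<phi> z) < 1\<close> big by (auto simp: t_def)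
  have "1 / (2 * (real J + 1)) \<le> 1 / 2" by (simp add: field_simps)
  hence t2: "t < 1 / 2" using t by linarith
  \<comment> \<open>The rounding keeps \<open>j\<close> within 1 above \<open>1 / (2 * t)\<close>.\<close>
  define j where "j = nat \<lfloor>1 / (2 * t)\<rfloor> + 1"
  have fl: "real (nat \<lfloor>1 / (2 * t)\<rfloor>) = of_int \<lfloor>1 / (2 * t)\<rfloor>" using t by simp
  have j1: "1 / (2 * t) \<le> real j" "real j \<le> 1 / (2 * t) + 1" "1 \<le> j"
    unfolding j_def of_nat_add fl by (auto simp: algebra_simps) linarith+
  have "real J + 1 < 1 / (2 * t)" using t by (simp add: field_simps)
  hence "real J \<le> real j" using j1(1) by linarith
  hence J: "J \<le> j" by simp
  define p where "p = real j * cmod (\<phi> z) ^ (j - 1)"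
  have p: "0 < p" using j1(3) t2 r by (simp add: p_def)
  have "D z * p \<le> c * monomial_norm j" unfolding p_def by (rule le[OF J j1(3) z])
  also have "\<dots> \<le> c * ln (3 * real j)" by (intro mult_left_mono monomial_norm_le j1(3) c)
  also have "\<dots> \<le> c * (4 * (v_log (\<phi> z) * p))"
    unfolding p_def using j1(1,2) t t2 \<open>cmod (\<phi> z) < 1\<close>
    by (intro mult_left_mono ln_le_v_log_deriv_monomial c) (simp_all add: t_def[symmetric])
  finally have "D z * p \<le> (4 * c * v_log (\<phi> z)) * p" by (simp only: mult_ac)
  thus "D z \<le> 4 * c * v_log (\<phi> z)" using p by simp
qed

lemma deriv_in_growth_ball:
  assumes "f \<in> bloch_unit_ball v_log"
  shows "deriv f \<in> growth_ball"
proof -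
  have f: "f \<in> bloch_space v_log" "bloch_norm v_log f \<le> 1"
    using assms by (simp_all add: bloch_unit_ball_def)
  have "v_log z * cmod (deriv f z) \<le> 1" if "z \<in> unit_disk" for z
    using deriv_le_bloch_norm[OF f(1) that] f(2) by (rule order_trans)
  thus ?thesis
    using holomorphic_deriv[OF bloch_space_holomorphic[OF f(1)] open_ball] by (simp add: growth_ball_def)
qed

text \<open>A finite bound for each \<open>n\<close> makes the operators below compact. The exponent is \<open>n - 1\<close> because
  the estimate is Cauchy's inequality for the derivative; the summand 1 covers the constant coefficient.\<close>

lemma taylor_coeff_bound:
  assumes f: "f \<in> bloch_unit_ball v_log"
  shows "cmod (taylor_coeff f n) \<le> 1 + 1 / (v_log (1 / 2) * (1 / 2) ^ (n - 1))"
proof (cases n)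
  case 0
  have "cmod (f 0) \<le> 1"
    using f enn2real_nonneg[of "bloch_seminorm v_log f"]
    unfolding bloch_unit_ball_def bloch_norm_def by (simp del: enn2real_nonneg)
  moreover have "0 < v_log (1 / 2)" by (rule v_log_pos) simp
  ultimately show ?thesis using 0 by (simp add: taylor_coeff_def add_increasing2)
next
  case (Suc m)
  have "cmod (taylor_coeff (deriv f) m) = real (Suc m) * cmod (taylor_coeff f n)"
    unfolding taylor_coeff_deriv Suc by (simp only: norm_mult norm_of_nat)
  moreover have "1 * cmod (taylor_coeff f n) \<le> real (Suc m) * cmod (taylor_coeff f n)"
    by (intro mult_right_mono) auto
  moreover have "cmod (taylor_coeff (deriv f) m) \<le> 1 / (v_log (1 / 2) * (1 / 2) ^ m)"
    using taylor_coeff_le[OF deriv_in_growth_ball[OF f], of "1 / 2" m] by simp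
  ultimately show ?thesis unfolding Suc by simp
qed

definition disk_power :: "(complex \<Rightarrow> complex) \<Rightarrow> nat \<Rightarrow> complex \<Rightarrow> complex" where
  "disk_power \<phi> n z = (if z \<in> unit_disk then \<phi> z ^ n else 0)"

lemma disk_power_in_space:
  assumes "linear_op v_log \<mu> (composition_op \<phi>)" and "\<phi> ` unit_disk \<subseteq> unit_disk"
  shows "disk_power \<phi> n \<in> bloch_space \<mu>"
proof -
  have "disk_power (\<lambda>z. z) n \<in> bloch_space v_log"
  proof (cases "n = 0")
    case True
    have "bloch_seminorm v_log (disk_power (\<lambda>z. z) n) = bloch_seminorm v_log (\<lambda>z. 1)"
      by (rule bloch_seminorm_cong) (simp add: disk_power_def True)
    also have "\<dots> \<le> ennreal 0" by (rule bloch_seminorm_le) simp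
    finally have "bloch_seminorm v_log (disk_power (\<lambda>z. z) n) < \<infinity>" by simp
    moreover have "disk_power (\<lambda>z. z) n holomorphic_on unit_disk"
      by (rule holomorphic_transform[of "\<lambda>z. z ^ n"]) (auto intro!: holomorphic_intros simp: disk_power_def)
    ultimately show ?thesis by (simp add: bloch_space_def disk_power_def)
  next
    case False
    have "disk_power (\<lambda>z. z) n = (\<lambda>z. complex_of_real (monomial_norm n) * unit_monomial n z)"
      using monomial_norm_pos[of n] False by (auto simp: disk_power_def unit_monomial_def fun_eq_iff)
    thus ?thesis using bloch_space_scale_and_norm(1)[OF unit_monomial_in_space[of n]] False by simp
  qed
  from linear_op_closed[OF assms(1) this]
  have "composition_op \<phi> (disk_power (\<lambda>z. z) n) \<in> bloch_space \<mu>" .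
  also have "composition_op \<phi> (disk_power (\<lambda>z. z) n) = disk_power \<phi> n"
  proof
    fix z
    have "z \<in> unit_disk \<Longrightarrow> \<phi> z \<in> unit_disk" using assms(2) by blast
    thus "composition_op \<phi> (disk_power (\<lambda>z. z) n) z = disk_power \<phi> n z"
      by (simp add: composition_op_def disk_power_def)
  qed
  finally show ?thesis .
qed

text \<open>Composition with \<open>\<phi>\<close> after replacing \<open>f\<close> by the Taylor polynomial of degree \<open>N\<close> of its dilation \<open>f (r * z)\<close>.\<close>

definition dilated_taylor_op :: "real \<Rightarrow> nat \<Rightarrow> (complex \<Rightarrow> complex) \<Rightarrow> operator" where
  "dilated_taylor_op r N \<phi> f = (\<lambda>z. \<Sum>n<Suc N. (taylor_coeff f n * of_real r ^ n) * disk_power \<phi> n z)"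

lemma compact_dilated_taylor_op:
  assumes \<mu>: "weight \<mu>" and lin: "linear_op v_log \<mu> (composition_op \<phi>)"
    and \<phi>: "\<phi> ` unit_disk \<subseteq> unit_disk" and r: "0 < r" "r < 1"
  shows "compact_linear_op v_log \<mu> (dilated_taylor_op r N \<phi>)"
proof -
  have "compact_linear_op v_log \<mu>
      (\<lambda>f z. \<Sum>n<Suc N. (taylor_coeff f n * of_real r ^ n) * disk_power \<phi> n z)"
  proof (rule finite_rank_compact[OF \<mu>, where M = "\<lambda>n. 1 + 1 / (v_log (1 / 2) * (1 / 2) ^ (n - 1))"])
    fix n f g assume "f \<in> bloch_space v_log" "g \<in> bloch_space v_log"
    hence h: "f holomorphic_on unit_disk" "g holomorphic_on unit_disk"
      by (simp_all add: bloch_space_def)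
    have "(deriv ^^ n) (\<lambda>z. f z + g z) 0 = (deriv ^^ n) f 0 + (deriv ^^ n) g 0"
      by (rule higher_deriv_add[OF h open_ball]) simp
    thus "taylor_coeff (\<lambda>z. f z + g z) n * of_real r ^ n
        = taylor_coeff f n * of_real r ^ n + taylor_coeff g n * of_real r ^ n"
      by (simp add: taylor_coeff_def add_divide_distrib distrib_right)
  next
    fix n c f assume "f \<in> bloch_space v_log"
    hence h: "f holomorphic_on unit_disk" by (simp add: bloch_space_def)
    have "(deriv ^^ n) (\<lambda>z. c * f z) 0 = c * (deriv ^^ n) f 0"
      by (rule higher_deriv_cmult[OF h _ open_ball]) simp
    thus "taylor_coeff (\<lambda>z. c * f z) n * of_real r ^ n = c * (taylor_coeff f n * of_real r ^ n)"
      by (simp add: taylor_coeff_def)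
  next
    fix n f assume f: "f \<in> bloch_unit_ball v_log"
    have "cmod (taylor_coeff f n * of_real r ^ n) \<le> cmod (taylor_coeff f n)"
      using r power_le_one[of r n] by (simp add: norm_mult norm_power mult_left_le)
    also have "\<dots> \<le> 1 + 1 / (v_log (1 / 2) * (1 / 2) ^ (n - 1))" by (rule taylor_coeff_bound[OF f])
    finally show "cmod (taylor_coeff f n * of_real r ^ n) \<le> 1 + 1 / (v_log (1 / 2) * (1 / 2) ^ (n - 1))" .
  qed (rule disk_power_in_space[OF lin \<phi>])
  thus ?thesis by (simp only: dilated_taylor_op_def[abs_def])
qed

lemma dilated_taylor_polynomial_derivative:
  "((\<lambda>w. \<Sum>n<Suc N. taylor_coeff f n * of_real r ^ n * w ^ n) has_field_derivative
     (\<Sum>n<N. taylor_coeff (deriv f) n * of_real r ^ Suc n * w ^ n)) (at w)"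
proof -
  have "((\<lambda>w. \<Sum>n<Suc N. taylor_coeff f n * of_real r ^ n * w ^ n) has_field_derivative
     (\<Sum>n<Suc N. taylor_coeff f n * of_real r ^ n * (of_nat n * w ^ (n - 1)))) (at w)"
    by (intro DERIV_sum DERIV_cmult) (auto intro!: derivative_eq_intros)
  also have "(\<Sum>n<Suc N. taylor_coeff f n * of_real r ^ n * (of_nat n * w ^ (n - 1)))
      = (\<Sum>n<N. taylor_coeff f (Suc n) * of_real r ^ Suc n * (of_nat (Suc n) * w ^ n))"
    by (subst sum.lessThan_Suc_shift) simp
  also have "\<dots> = (\<Sum>n<N. taylor_coeff (deriv f) n * of_real r ^ Suc n * w ^ n)"
    by (intro sum.cong refl) (simp only: taylor_coeff_deriv mult_ac)
  finally show ?thesis .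
qed

text \<open>Subtract a dilated Taylor operator and let \<open>G\<close> be the approximation error of \<open>f\<close>. Where \<open>|\<phi> z| \<le> R\<close>, the derivative
  of \<open>G\<close> is small and \<open>\<mu> * |\<phi>'|\<close> is bounded because \<open>\<phi>\<close> is the image of the identity. Elsewhere the derivative of \<open>G\<close> is
  at most \<open>3 / v_log\<close>, and the hypothesis absorbs this factor, with cost \<open>4 * 3 * c\<close>. The value at 0 contributes one
  further \<open>c\<close>, as \<open>G\<close> vanishes at 0 and has small derivative on the disk of radius \<open>R\<close>, which contains \<open>\<phi> 0\<close>.\<close>

lemma essential_norm_le:
  assumes \<mu>: "weight \<mu>" and \<phi>: "\<phi> holomorphic_on unit_disk" "\<phi> ` unit_disk \<subseteq> unit_disk"
    and lin: "linear_op v_log \<mu> (composition_op \<phi>)" and c: "0 < c"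
    and R0: "R0 < 1" "\<And>z. z \<in> unit_disk \<Longrightarrow> R0 < cmod (\<phi> z) \<Longrightarrow>
              \<mu> z * cmod (deriv \<phi> z) \<le> 4 * c * v_log (\<phi> z)"
  shows "essential_norm v_log \<mu> (composition_op \<phi>) \<le> ennreal (13 * c)"
proof -
  have \<phi>0: "\<phi> 0 \<in> unit_disk" by (rule subsetD[OF \<phi>(2) imageI]) simp
  \<comment> \<open>The disk of radius \<open>R\<close> must contain \<open>\<phi> 0\<close> for the value at 0 to be controlled as well.\<close>
  define R where "R = max (max R0 (1 / 2)) (cmod (\<phi> 0))"
  have R: "0 < R" "R < 1" "R0 \<le> R" "cmod (\<phi> 0) \<le> R" using R0(1) \<phi>0 by (auto simp: R_def)
  define M where "M = bloch_norm \<mu> (disk_power \<phi> 1)"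
  have M0: "0 \<le> M" by (simp add: M_def)
  have M: "\<mu> z * cmod (deriv \<phi> z) \<le> M" if z: "z \<in> unit_disk" for z
  proof -
    have "deriv (disk_power \<phi> 1) z = deriv \<phi> z"
      using eventually_nhds_in_open[OF open_ball z]
      by (intro deriv_cong_ev) (auto elim!: eventually_mono simp: disk_power_def)
    thus ?thesis
      using deriv_le_bloch_norm[OF disk_power_in_space[OF lin \<phi>(2)] z, of 1] by (simp add: M_def)
  qed
  \<comment> \<open>The three uses of smallness: \<open>2 + 2 * \<epsilon> \<le> 3\<close>, \<open>M * \<epsilon> \<le> c\<close> and \<open>\<epsilon> \<le> c\<close>.\<close>
  define \<epsilon> where "\<epsilon> = min (1 / 2) (c / (1 + M))"
  have \<epsilon>_pos: "0 < \<epsilon>" unfolding \<epsilon>_def using c M0 by simp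
  have "\<epsilon> \<le> 1 / 2" unfolding \<epsilon>_def by (rule min.cobounded1)
  note \<epsilon> = \<epsilon>_pos this
  have "\<epsilon> \<le> c / (1 + M)" by (simp add: \<epsilon>_def)
  hence "\<epsilon> * (1 + M) \<le> c" using M0 by (simp add: pos_le_divide_eq)
  hence "\<epsilon> + M * \<epsilon> \<le> c" by (simp add: algebra_simps)
  moreover have "0 \<le> M * \<epsilon>" using M0 \<epsilon> by simp
  ultimately have \<epsilon>c: "\<epsilon> \<le> c" "M * \<epsilon> \<le> c" using \<epsilon>(1) by linarith+
  obtain r N where r: "0 < r" "r < 1"
    and small: "\<And>h z. h \<in> growth_ball \<Longrightarrow> cmod z \<le> R \<Longrightarrow>
        cmod (h z - (\<Sum>n<N. taylor_coeff h n * of_real r ^ Suc n * z ^ n)) \<le> \<epsilon>"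
    and bounded: "\<And>h z. h \<in> growth_ball \<Longrightarrow> cmod z < 1 \<Longrightarrow>
        v_log z * cmod (h z - (\<Sum>n<N. taylor_coeff h n * of_real r ^ Suc n * z ^ n)) \<le> 2 + 2 * \<epsilon>"
    using taylor_approximation[OF R(1,2) \<epsilon>(1)] by blast
  define K where "K = dilated_taylor_op r N \<phi>"
  have K: "compact_linear_op v_log \<mu> K"
    unfolding K_def by (rule compact_dilated_taylor_op[OF \<mu> lin \<phi>(2) r])
  have "bloch_norm \<mu> (\<lambda>z. composition_op \<phi> f z - K f z) \<le> 13 * c" if f: "f \<in> bloch_unit_ball v_log" for f
  proof -
    have fh: "f holomorphic_on unit_disk"
      using f by (simp add: bloch_unit_ball_def bloch_space_def)
    have H: "deriv f \<in> growth_ball" by (rule deriv_in_growth_ball[OF f])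
    define G where "G = (\<lambda>w. f w - (\<Sum>n<Suc N. taylor_coeff f n * of_real r ^ n * w ^ n))"
    define G' where "G' = (\<lambda>w. deriv f w - (\<Sum>n<N. taylor_coeff (deriv f) n * of_real r ^ Suc n * w ^ n))"
    have G: "(G has_field_derivative G' w) (at w)" if "w \<in> unit_disk" for w
      unfolding G_def G'_def
      by (rule DERIV_diff[OF holomorphic_derivI[OF fh open_ball that] dilated_taylor_polynomial_derivative])
    have G'small: "cmod (G' w) \<le> \<epsilon>" if "cmod w \<le> R" for w
      unfolding G'_def by (rule small[OF H that])
    have G'bd: "v_log w * cmod (G' w) \<le> 2 + 2 * \<epsilon>" if "cmod w < 1" for w
      unfolding G'_def by (rule bounded[OF H that])
    have eq: "composition_op \<phi> f z - K f z = G (\<phi> z)" if "z \<in> unit_disk" for z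
      using that by (simp add: composition_op_def K_def dilated_taylor_op_def disk_power_def G_def)
    have "cmod (composition_op \<phi> f 0 - K f 0) \<le> c"
    proof -
      have "G 0 = 0" by (simp add: G_def taylor_coeff_def sum.lessThan_Suc_shift del: sum.lessThan_Suc)
      have "cmod (G (\<phi> 0) - G 0) \<le> \<epsilon> * cmod (\<phi> 0 - 0)"
      proof (rule field_differentiable_bound[of "cball 0 R" G G'])
        fix w :: complex assume "w \<in> cball 0 R"
        hence w: "cmod w \<le> R" by simp
        show "(G has_field_derivative G' w) (at w within cball 0 R)"
          using w R by (intro has_field_derivative_at_within[OF G]) auto
        show "cmod (G' w) \<le> \<epsilon>" by (rule G'small[OF w])
      qed (use R in auto)
      also have "\<dots> \<le> \<epsilon>" using \<epsilon> R by (simp add: mult_left_le)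
      finally show ?thesis using \<open>G 0 = 0\<close> eq[of 0] \<epsilon>c by simp
    qed
    moreover have "bloch_norm \<mu> (\<lambda>z. composition_op \<phi> f z - K f z)
        \<le> cmod (composition_op \<phi> f 0 - K f 0) + 12 * c"
    proof (rule bloch_norm_le)
      fix z assume z: "z \<in> unit_disk"
      have \<phi>z: "\<phi> z \<in> unit_disk" using \<phi>(2) z by blast
      have "((\<lambda>z. G (\<phi> z)) has_field_derivative G' (\<phi> z) * deriv \<phi> z) (at z)"
        by (rule DERIV_chain2[OF G[OF \<phi>z] holomorphic_derivI[OF \<phi>(1) open_ball z]])
      hence "((\<lambda>z. composition_op \<phi> f z - K f z) has_field_derivative G' (\<phi> z) * deriv \<phi> z) (at z)"
        by (rule has_field_derivative_transform_within_open[OF _ open_ball z]) (simp add: eq)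
      hence "deriv (\<lambda>z. composition_op \<phi> f z - K f z) z = G' (\<phi> z) * deriv \<phi> z"
        by (rule DERIV_imp_deriv)
      hence d: "\<mu> z * cmod (deriv (\<lambda>z. composition_op \<phi> f z - K f z) z)
          = (\<mu> z * cmod (deriv \<phi> z)) * cmod (G' (\<phi> z))"
        by (simp add: norm_mult mult_ac)
      show "\<mu> z * cmod (deriv (\<lambda>z. composition_op \<phi> f z - K f z) z) \<le> 12 * c"
      proof (cases "cmod (\<phi> z) \<le> R")
        case True
        have "(\<mu> z * cmod (deriv \<phi> z)) * cmod (G' (\<phi> z)) \<le> M * \<epsilon>"
          by (rule mult_mono[OF M[OF z] G'small[OF True] M0]) simp
        thus ?thesis unfolding d using \<epsilon>c c by linarith
      next
        case False
        hence "R0 < cmod (\<phi> z)" using R by linarith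
        hence "(\<mu> z * cmod (deriv \<phi> z)) * cmod (G' (\<phi> z)) \<le> (4 * c * v_log (\<phi> z)) * cmod (G' (\<phi> z))"
          by (intro mult_right_mono R0(2) z) auto
        also have "\<dots> = 4 * c * (v_log (\<phi> z) * cmod (G' (\<phi> z)))" by (simp only: mult_ac)
        also have "\<dots> \<le> 4 * c * 3"
          using G'bd[of "\<phi> z"] \<phi>z \<epsilon>(2) c by (intro mult_left_mono) auto
        finally show ?thesis unfolding d by simp
      qed
    qed (use c in simp)
    ultimately show ?thesis by linarith
  qed
  hence "operator_norm v_log \<mu> (\<lambda>f z. composition_op \<phi> f z - K f z) \<le> ennreal (13 * c)"
    unfolding operator_norm_def by (intro SUP_least ennreal_leI)
  thus ?thesis unfolding essential_norm_def using K by (intro INF_lower2[of K]) auto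
qed

lemma essential_norm_le_limsup:
  assumes \<mu>: "weight \<mu>" and \<phi>: "\<phi> holomorphic_on unit_disk" "\<phi> ` unit_disk \<subseteq> unit_disk"
    and C: "bounded_linear_op v_log \<mu> (composition_op \<phi>)"
    and c: "0 < c"
    and L: "limsup (\<lambda>j. bloch_seminorm \<mu> (\<lambda>z. \<phi> z ^ j) / bloch_seminorm v_log (\<lambda>z. z ^ j)) < ennreal c"
  shows "essential_norm v_log \<mu> (composition_op \<phi>) \<le> ennreal (13 * c)"
proof -
  have lin: "linear_op v_log \<mu> (composition_op \<phi>)" using C by (simp add: bounded_linear_op_def)
  obtain J where J: "\<And>j. J \<le> j \<Longrightarrow>
      bloch_seminorm \<mu> (\<lambda>z. \<phi> z ^ j) / bloch_seminorm v_log (\<lambda>z. z ^ j) < ennreal c"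
    using Limsup_lessD[OF L] unfolding eventually_sequentially by blast
  have "(\<mu> z * cmod (deriv \<phi> z)) * (real j * cmod (\<phi> z) ^ (j - 1)) \<le> c * monomial_norm j"
    if j: "J \<le> j" "1 \<le> j" and z: "z \<in> unit_disk" for j z
  proof -
    have F: "0 < monomial_norm j" by (rule monomial_norm_pos[OF j(2)])
    have "bloch_seminorm \<mu> (\<lambda>z. \<phi> z ^ j) / ennreal (monomial_norm j) < ennreal c"
      using J[OF j(1)] by (simp only: bloch_seminorm_monomial[OF j(2)])
    hence "bloch_seminorm \<mu> (\<lambda>z. \<phi> z ^ j) < ennreal c * ennreal (monomial_norm j)"
      using F by (subst (asm) divide_less_ennreal) auto
    also have "\<dots> = ennreal (c * monomial_norm j)" using c F by (simp add: ennreal_mult)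
    finally have "ennreal (\<mu> z * cmod (deriv (\<lambda>z. \<phi> z ^ j) z)) \<le> ennreal (c * monomial_norm j)"
      using bloch_seminorm_upper[OF z, of \<mu> "\<lambda>z. \<phi> z ^ j"] by simp
    hence "\<mu> z * cmod (deriv (\<lambda>z. \<phi> z ^ j) z) \<le> c * monomial_norm j"
      using c F by (subst (asm) ennreal_le_iff) auto
    thus ?thesis by (simp add: deriv_power_holomorphic[OF \<phi>(1) z] norm_mult norm_power mult_ac)
  qed
  from hyperbolic_derivative_bound[OF \<phi>(2) less_imp_le[OF c] this]
  obtain R0 where "R0 < 1" "\<And>z. z \<in> unit_disk \<Longrightarrow> R0 < cmod (\<phi> z) \<Longrightarrow>
      \<mu> z * cmod (deriv \<phi> z) \<le> 4 * c * v_log (\<phi> z)" by blast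
  thus ?thesis by (intro essential_norm_le[OF \<mu> \<phi> lin c]) auto
qed

theorem theorem5p1:
  "\<exists>K>0. \<forall>(\<mu> :: complex \<Rightarrow> real) (\<phi> :: complex \<Rightarrow> complex).
     weight \<mu> \<longrightarrow> \<phi> holomorphic_on unit_disk \<longrightarrow> \<phi> ` unit_disk \<subseteq> unit_disk \<longrightarrow>
     bounded_linear_op v_log \<mu> (composition_op \<phi>) \<longrightarrow>
       ennreal (1 / K) * essential_norm v_log \<mu> (composition_op \<phi>)
         \<le> limsup (\<lambda>j::nat. bloch_seminorm \<mu> (\<lambda>z. \<phi> z ^ j) / bloch_seminorm v_log (\<lambda>z. z ^ j)) \<and>
       limsup (\<lambda>j::nat. bloch_seminorm \<mu> (\<lambda>z. \<phi> z ^ j) / bloch_seminorm v_log (\<lambda>z. z ^ j))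
         \<le> ennreal K * essential_norm v_log \<mu> (composition_op \<phi>)"
proof (intro exI[of _ 13] conjI allI impI)
  fix \<mu> :: "complex \<Rightarrow> real" and \<phi> :: "complex \<Rightarrow> complex"
  assume \<mu>: "weight \<mu>" and \<phi>: "\<phi> holomorphic_on unit_disk" "\<phi> ` unit_disk \<subseteq> unit_disk"
    and C: "bounded_linear_op v_log \<mu> (composition_op \<phi>)"
  let ?L = "limsup (\<lambda>j::nat. bloch_seminorm \<mu> (\<lambda>z. \<phi> z ^ j) / bloch_seminorm v_log (\<lambda>z. z ^ j))"
  let ?E = "essential_norm v_log \<mu> (composition_op \<phi>)"
  show "ennreal (1 / 13) * ?E \<le> ?L"
  proof (rule dense_ge)
    fix x assume x: "?L < x"
    show "ennreal (1 / 13) * ?E \<le> x"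
    proof (cases x)
      case (real c)
      have "0 < x" using x by (rule le_less_trans[OF zero_le])
      hence c: "0 < c" using real by simp
      have "?E \<le> ennreal (13 * c)"
        using x unfolding real(2) by (rule essential_norm_le_limsup[OF \<mu> \<phi> C c])
      hence "ennreal (1 / 13) * ?E \<le> ennreal (1 / 13) * ennreal (13 * c)"
        by (rule mult_left_mono) simp
      also have "\<dots> = x" using c unfolding real(2) by (subst ennreal_mult[symmetric]) auto
      finally show ?thesis .
    qed simp
  qed
  have "?L \<le> ?E" by (rule limsup_le_essential_norm[OF \<mu> \<phi> C])
  also have "?E = 1 * ?E" by simp
  also have "\<dots> \<le> ennreal 13 * ?E" by (intro mult_right_mono) auto
  finally show "?L \<le> ennreal 13 * ?E" .
qed simp

end
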